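(* Let $G$ be a topological group and let $X$ be a $G$-space. If the family $\bar U_G$ is a uniformity on $X$ compatible with the topology of $X$, then the maximal $G$-compactification $\beta_G X$ is the Samuel compactification of $X$ with respect to $\bar U_G$.
   Context: All spaces are Tychonoff. A $G$-space is a Tychonoff space $X$ with a continuous action $G\times X\to X$ of the topological group $G$. A $G$-compactification of $X$ is a compact (Hausdorff) $G$-space $bX$ together with an equivariant dense topological embedding $X\to bX$. $G$-compactifications are ordered by $bX\ge b'X$ iff there is a continuous equivariant map $bX\to b'X$ that is the identity on $X$; the largest element (it exists whenever $X$ has some $G$-compactification) is the maximal $G$-compactification $\beta_G X$. Uniformities are described by coverings: a uniformity on $X$ is a family $U$ of coverings of $X$ such that (1) if $\gamma\in U$ refines a covering $\beta$ then $\beta\in U$; (2) any two members of $U$ have a common refinement in $U$; (3) every member of $U$ has a star refinement in $U$; (4) for distinct $x,y\in X$ some $\gamma\in U$ has no element containing both $x$ and $y$. The induced topology: $W$ is open iff for each $x\in W$ there is $\gamma\in U$ with $\mathrm{st}(x,\gamma)=\bigcup\{E\in\gamma: x\in E\}\subset W$. $U$ is compatible with the topology of $X$ if the induced topology equals the topology of $X$. For an open neighbourhood $O$ of the identity in $G$ put $\bar\gamma_O=\{\mathrm{cl}(Ox): x\in X\}$, where $Ox=\{gx: g\in O\}$. $\bar U_G$ is the family of all coverings of $X$ which have a refinement of the form $\bar\gamma_O$, with $O$ an open neighbourhood of the identity. The Samuel compactification of $X$ with respect to a compatible uniformity $U$ is the completion of $X$ with respect to the totally bounded uniformity consisting of all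 coverings refined by a finite covering from $U$. The conclusion means that $X$ has a $G$-compactification, that the action of $G$ extends to a continuous action on this Samuel compactification, and that the resulting $G$-compactification is $\beta_G X$. *)

theory Defs
  imports "HOL-Analysis.Analysis" "HOL-Algebra.Group_Action"
begin

section \<open>Uniformities given by coverings\<close>

definition covering_of :: "'a set \<Rightarrow> 'a set set \<Rightarrow> bool" where
  "covering_of S \<alpha> \<longleftrightarrow> \<Union>\<alpha> = S"

definition cover_refines :: "'a set set \<Rightarrow> 'a set set \<Rightarrow> bool" where
  "cover_refines \<alpha> \<beta> \<longleftrightarrow> (\<forall>A\<in>\<alpha>. \<exists>B\<in>\<beta>. A \<subseteq> B)"

definition cover_star :: "'a set \<Rightarrow> 'a set set \<Rightarrow> 'a set" where
  "cover_star A \<alpha> = \<Union>{E\<in>\<alpha>. A \<inter> E \<noteq> {}}"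

definition star_refines :: "'a set set \<Rightarrow> 'a set set \<Rightarrow> bool" where
  "star_refines \<alpha> \<beta> \<longleftrightarrow> (\<forall>A\<in>\<alpha>. \<exists>B\<in>\<beta>. cover_star A \<alpha> \<subseteq> B)"

definition covering_uniformity :: "'a set \<Rightarrow> 'a set set set \<Rightarrow> bool" where
  "covering_uniformity S U \<longleftrightarrow>
     (\<forall>\<alpha>\<in>U. covering_of S \<alpha>) \<and>
     (\<forall>\<alpha>\<in>U. \<forall>\<beta>. covering_of S \<beta> \<and> cover_refines \<alpha> \<beta> \<longrightarrow> \<beta> \<in> U) \<and>
     (\<forall>\<alpha>\<in>U. \<forall>\<beta>\<in>U. \<exists>\<gamma>\<in>U. cover_refines \<gamma> \<alpha> \<and> cover_refines \<gamma> \<beta>) \<and>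
     (\<forall>\<alpha>\<in>U. \<exists>\<beta>\<in>U. star_refines \<beta> \<alpha>) \<and>
     (\<forall>x\<in>S. \<forall>y\<in>S. x \<noteq> y \<longrightarrow> (\<exists>\<gamma>\<in>U. \<not> (\<exists>E\<in>\<gamma>. x \<in> E \<and> y \<in> E)))"

definition uniform_topology :: "'a set \<Rightarrow> 'a set set set \<Rightarrow> 'a topology" where
  "uniform_topology S U =
     topology (\<lambda>W. W \<subseteq> S \<and> (\<forall>x\<in>W. \<exists>\<gamma>\<in>U. cover_star {x} \<gamma> \<subseteq> W))"

definition compatible_uniformity :: "'a topology \<Rightarrow> 'a set set set \<Rightarrow> bool" where
  "compatible_uniformity X U \<longleftrightarrow> uniform_topology (topspace X) U = X"

lemma cover_refines_trans:
  "cover_refines \<alpha> \<beta> \<Longrightarrow> cover_refines \<beta> \<gamma> \<Longrightarrow> cover_refines \<alpha> \<gamma>"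
  unfolding cover_refines_def by (meson subset_trans)

lemma covering_uniformity_covering_of:
  "covering_uniformity S U \<Longrightarrow> \<alpha> \<in> U \<Longrightarrow> covering_of S \<alpha>"
  by (simp add: covering_uniformity_def)

lemma cover_star_singleton: "cover_star {x} \<alpha> = \<Union>{E\<in>\<alpha>. x \<in> E}"
  by (auto simp: cover_star_def)

lemma cover_star_refines:
  "cover_refines \<alpha> \<beta> \<Longrightarrow> cover_star A \<alpha> \<subseteq> cover_star A \<beta>"
  unfolding cover_refines_def cover_star_def by fastforce

lemma openin_uniform_topology:
  assumes "covering_uniformity S U"
  shows "openin (uniform_topology S U) W \<longleftrightarrow>
           W \<subseteq> S \<and> (\<forall>x\<in>W. \<exists>\<gamma>\<in>U. cover_star {x} \<gamma> \<subseteq> W)"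
proof -
  let ?P = "\<lambda>W. W \<subseteq> S \<and> (\<forall>x\<in>W. \<exists>\<gamma>\<in>U. cover_star {x} \<gamma> \<subseteq> W)"
  have "istopology ?P"
    unfolding istopology_def
  proof (intro conjI allI impI)
    fix V W assume V: "?P V" and W: "?P W"
    show "V \<inter> W \<subseteq> S" using V by blast
    show "\<forall>x\<in>V \<inter> W. \<exists>\<gamma>\<in>U. cover_star {x} \<gamma> \<subseteq> V \<inter> W"
    proof
      fix x assume x: "x \<in> V \<inter> W"
      obtain \<alpha> \<beta> where ab: "\<alpha> \<in> U" "\<beta> \<in> U" "cover_star {x} \<alpha> \<subseteq> V" "cover_star {x} \<beta> \<subseteq> W"
        using V W x by blast
      then obtain \<gamma> where "\<gamma> \<in> U" "cover_refines \<gamma> \<alpha>" "cover_refines \<gamma> \<beta>"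
        using assms unfolding covering_uniformity_def by meson
      then show "\<exists>\<gamma>\<in>U. cover_star {x} \<gamma> \<subseteq> V \<inter> W"
        using ab cover_star_refines by (metis le_inf_iff subset_trans)
    qed
  next
    fix K assume K: "\<forall>W\<in>K. ?P W"
    show "\<Union>K \<subseteq> S" using K by blast
    show "\<forall>x\<in>\<Union>K. \<exists>\<gamma>\<in>U. cover_star {x} \<gamma> \<subseteq> \<Union>K"
      using K by (meson Union_iff Union_upper subset_trans)
  qed
  then show ?thesis
    unfolding uniform_topology_def by simp
qed


section \<open>Completion and Samuel compactification\<close>

text \<open>
  The completion is the space of minimal Cauchy filters. In the order of type
  \<^typ>\<open>'a filter\<close> finer filters are smaller, so minimality with respect to inclusion
  of filters is maximality with respect to \<open>\<le>\<close>.
\<close>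

definition cauchy_filter_wrt :: "'a set \<Rightarrow> 'a set set set \<Rightarrow> 'a filter \<Rightarrow> bool" where
  "cauchy_filter_wrt S U F \<longleftrightarrow>
     F \<noteq> bot \<and> F \<le> principal S \<and> (\<forall>\<gamma>\<in>U. \<exists>E\<in>\<gamma>. eventually (\<lambda>x. x \<in> E) F)"

definition completion_points :: "'a set \<Rightarrow> 'a set set set \<Rightarrow> 'a filter set" where
  "completion_points S U =
     {F. cauchy_filter_wrt S U F \<and> (\<forall>F'. cauchy_filter_wrt S U F' \<and> F \<le> F' \<longrightarrow> F' = F)}"

definition completion_lift :: "'a set \<Rightarrow> 'a set set set \<Rightarrow> 'a set \<Rightarrow> 'a filter set" where
  "completion_lift S U E = {F \<in> completion_points S U. eventually (\<lambda>x. x \<in> E) F}"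

definition completion_uniformity :: "'a set \<Rightarrow> 'a set set set \<Rightarrow> 'a filter set set set" where
  "completion_uniformity S U =
     {\<alpha>. covering_of (completion_points S U) \<alpha> \<and>
          (\<exists>\<gamma>\<in>U. cover_refines (completion_lift S U ` \<gamma>) \<alpha>)}"

definition completion_map :: "'a set \<Rightarrow> 'a set set set \<Rightarrow> 'a \<Rightarrow> 'a filter" where
  "completion_map S U x = nhdsin (uniform_topology S U) x"

definition totally_bounded_part :: "'a set \<Rightarrow> 'a set set set \<Rightarrow> 'a set set set" where
  "totally_bounded_part S U =
     {\<alpha>. covering_of S \<alpha> \<and> (\<exists>\<beta>\<in>U. finite \<beta> \<and> cover_refines \<beta> \<alpha>)}"

definition samuel_compactification :: "'a set \<Rightarrow> 'a set set set \<Rightarrow> 'a filter topology" where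
  "samuel_compactification S U =
     uniform_topology (completion_points S (totally_bounded_part S U))
       (completion_uniformity S (totally_bounded_part S U))"

definition samuel_map :: "'a set \<Rightarrow> 'a set set set \<Rightarrow> 'a \<Rightarrow> 'a filter" where
  "samuel_map S U = completion_map S (totally_bounded_part S U)"

lemma covering_uniformity_totally_bounded_part:
  assumes U: "covering_uniformity S U"
  shows "covering_uniformity S (totally_bounded_part S U)"
  unfolding covering_uniformity_def
proof (intro conjI ballI allI impI)
  fix \<alpha> assume "\<alpha> \<in> totally_bounded_part S U"
  then show "covering_of S \<alpha>" by (simp add: totally_bounded_part_def)
next
  fix \<alpha> \<beta> assume "\<alpha> \<in> totally_bounded_part S U" "covering_of S \<beta> \<and> cover_refines \<alpha> \<beta>"
  then show "\<beta> \<in> totally_bounded_part S U"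
    unfolding totally_bounded_part_def using cover_refines_trans by blast
next
  fix \<alpha> \<beta> assume "\<alpha> \<in> totally_bounded_part S U" "\<beta> \<in> totally_bounded_part S U"
  then obtain a b where a: "a \<in> U" "finite a" "cover_refines a \<alpha>"
    and b: "b \<in> U" "finite b" "cover_refines b \<beta>"
    by (auto simp: totally_bounded_part_def)
  obtain c where c: "c \<in> U" "cover_refines c a" "cover_refines c b"
    using U a b unfolding covering_uniformity_def by meson
  let ?d = "(\<lambda>(A, B). A \<inter> B) ` (a \<times> b)"
  have cov: "covering_of S a" "covering_of S b"
    using covering_uniformity_covering_of[OF U] a b by simp_all
  have d: "covering_of S ?d" "finite ?d"
    using cov a b unfolding covering_of_def by auto
  have "cover_refines c ?d"
    unfolding cover_refines_def
  proof
    fix C assume "C \<in> c"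
    then obtain A B where "A \<in> a" "B \<in> b" "C \<subseteq> A" "C \<subseteq> B"
      using c unfolding cover_refines_def by meson
    then show "\<exists>D\<in>?d. C \<subseteq> D" by (intro bexI[of _ "A \<inter> B"]) auto
  qed
  then have "?d \<in> U" using U c d unfolding covering_uniformity_def by meson
  then have "?d \<in> totally_bounded_part S U"
    using d unfolding totally_bounded_part_def cover_refines_def by blast
  moreover have "cover_refines ?d a" "cover_refines ?d b"
    unfolding cover_refines_def by auto
  ultimately show "\<exists>\<gamma>\<in>totally_bounded_part S U. cover_refines \<gamma> \<alpha> \<and> cover_refines \<gamma> \<beta>"
    using a(3) b(3) cover_refines_trans by meson
next
  fix \<alpha> assume "\<alpha> \<in> totally_bounded_part S U"
  then obtain c where c: "c \<in> U" "finite c" "cover_refines c \<alpha>"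
    by (auto simp: totally_bounded_part_def)
  obtain b where b: "b \<in> U" "star_refines b c"
    using U c unfolding covering_uniformity_def by meson
  define k where "k B = ({E\<in>c. B \<subseteq> E}, {E\<in>c. cover_star B b \<subseteq> E})" for B
  define D where "D B = \<Union>{B'\<in>b. k B' = k B}" for B
  have "k ` b \<subseteq> Pow c \<times> Pow c" by (auto simp: k_def)
  then have "finite (k ` b)" by (rule finite_subset) (use c in auto)
  moreover have "D ` b = (\<lambda>j. \<Union>{B'\<in>b. k B' = j}) ` (k ` b)"
    by (auto simp: D_def)
  ultimately have fin: "finite (D ` b)" by simp
  have cov: "covering_of S (D ` b)"
  proof -
    have "\<Union>(D ` b) = \<Union>b" by (auto simp: D_def)
    moreover have "covering_of S b" using covering_uniformity_covering_of[OF U] b by simp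
    ultimately show ?thesis by (simp add: covering_of_def)
  qed
  have "cover_refines b (D ` b)"
    unfolding cover_refines_def D_def by blast
  then have "D ` b \<in> U" using U b cov unfolding covering_uniformity_def by meson
  then have "D ` b \<in> totally_bounded_part S U"
    using fin cov unfolding totally_bounded_part_def cover_refines_def by blast
  moreover have "star_refines (D ` b) \<alpha>"
    unfolding star_refines_def
  proof
    fix A assume "A \<in> D ` b"
    then obtain B where B: "B \<in> b" "A = D B" by blast
    then obtain E where E: "E \<in> c" "cover_star B b \<subseteq> E"
      using b unfolding star_refines_def by meson
    have "cover_star A (D ` b) \<subseteq> E"
    proof
      fix y assume "y \<in> cover_star A (D ` b)"
      then obtain C x where C: "C \<in> b" "x \<in> D B" "x \<in> D C" "y \<in> D C"
        using B by (auto simp: cover_star_def)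
      obtain B1 where B1: "B1 \<in> b" "k B1 = k B" "x \<in> B1"
        using \<open>x \<in> D B\<close> unfolding D_def by blast
      obtain C1 where C1: "C1 \<in> b" "k C1 = k C" "x \<in> C1"
        using \<open>x \<in> D C\<close> unfolding D_def by blast
      obtain C2 where C2: "C2 \<in> b" "k C2 = k C" "y \<in> C2"
        using \<open>y \<in> D C\<close> unfolding D_def by blast
      have "E \<in> snd (k B1)" using E B1(2) by (simp add: k_def)
      then have "cover_star B1 b \<subseteq> E" by (simp add: k_def)
      then have "C1 \<subseteq> E" using B1 C1 unfolding cover_star_def by blast
      then have "E \<in> fst (k C1)" using E by (simp add: k_def)
      then have "E \<in> fst (k C2)" using C1(2) C2(2) by simp
      then have "C2 \<subseteq> E" by (simp add: k_def)
      then show "y \<in> E" using C2 by blast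
    qed
    then show "\<exists>A'\<in>\<alpha>. cover_star A (D ` b) \<subseteq> A'"
      using c E unfolding cover_refines_def by (meson subset_trans)
  qed
  ultimately show "\<exists>\<beta>\<in>totally_bounded_part S U. star_refines \<beta> \<alpha>" by blast
next
  fix x y assume xy: "x \<in> S" "y \<in> S" "x \<noteq> y"
  have "\<exists>\<gamma>\<in>U. \<not> (\<exists>E\<in>\<gamma>. x \<in> E \<and> y \<in> E)"
    using U xy by (simp add: covering_uniformity_def)
  then obtain c where c: "c \<in> U" "\<not> (\<exists>E\<in>c. x \<in> E \<and> y \<in> E)" by blast
  let ?d = "{S - {x}, S - {y}}"
  have "covering_of S ?d" using xy by (auto simp: covering_of_def)
  moreover have "cover_refines c ?d"
    unfolding cover_refines_def
  proof
    fix C assume C: "C \<in> c"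
    then have "C \<subseteq> S"
      using covering_uniformity_covering_of[OF U c(1)] unfolding covering_of_def by blast
    moreover have "x \<notin> C \<or> y \<notin> C" using C c(2) by blast
    ultimately show "\<exists>D\<in>?d. C \<subseteq> D" by (simp add: subset_Diff_insert)
  qed
  ultimately have "?d \<in> U" using U c unfolding covering_uniformity_def by meson
  moreover have "cover_refines ?d ?d" "finite ?d" by (auto simp: cover_refines_def)
  ultimately have "?d \<in> totally_bounded_part S U"
    using \<open>covering_of S ?d\<close> unfolding totally_bounded_part_def by blast
  moreover have "\<not> (\<exists>E\<in>?d. x \<in> E \<and> y \<in> E)" by simp
  ultimately show "\<exists>\<gamma>\<in>totally_bounded_part S U. \<not> (\<exists>E\<in>\<gamma>. x \<in> E \<and> y \<in> E)"
    by (rule bexI[rotated])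
qed

lemma covering_uniformity_completion:
  assumes U: "covering_uniformity S U"
  shows "covering_uniformity (completion_points S U) (completion_uniformity S U)"
proof -
  let ?L = "completion_lift S U"
  have cov: "covering_of (completion_points S U) (?L ` \<gamma>)" if "\<gamma> \<in> U" for \<gamma>
    using that unfolding covering_of_def completion_lift_def completion_points_def
      cauchy_filter_wrt_def by blast
  have mem: "?L ` \<gamma> \<in> completion_uniformity S U" if "\<gamma> \<in> U" for \<gamma>
    using cov[OF that] that unfolding completion_uniformity_def cover_refines_def by blast
  have mono: "?L A \<subseteq> ?L B" if "A \<subseteq> B" for A B
    using that unfolding completion_lift_def by (auto elim: eventually_mono)
  have mono': "cover_refines (?L ` \<alpha>) (?L ` \<beta>)" if "cover_refines \<alpha> \<beta>" for \<alpha> \<beta>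
    using that mono unfolding cover_refines_def by (metis (no_types, lifting) imageE imageI)
  show ?thesis
    unfolding covering_uniformity_def
  proof (intro conjI ballI allI impI)
    fix \<alpha> assume "\<alpha> \<in> completion_uniformity S U"
    then show "covering_of (completion_points S U) \<alpha>" by (simp add: completion_uniformity_def)
  next
    fix \<alpha> \<beta> assume "\<alpha> \<in> completion_uniformity S U"
      "covering_of (completion_points S U) \<beta> \<and> cover_refines \<alpha> \<beta>"
    then show "\<beta> \<in> completion_uniformity S U"
      using cover_refines_trans unfolding completion_uniformity_def by blast
  next
    fix \<alpha> \<beta> assume "\<alpha> \<in> completion_uniformity S U" "\<beta> \<in> completion_uniformity S U"
    then obtain a b where ab: "a \<in> U" "b \<in> U" "cover_refines (?L ` a) \<alpha>" "cover_refines (?L ` b) \<beta>"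
      by (auto simp: completion_uniformity_def)
    then obtain c where "c \<in> U" "cover_refines c a" "cover_refines c b"
      using U unfolding covering_uniformity_def by meson
    then show "\<exists>\<gamma>\<in>completion_uniformity S U. cover_refines \<gamma> \<alpha> \<and> cover_refines \<gamma> \<beta>"
      using ab mem mono' cover_refines_trans by meson
  next
    fix \<alpha> assume "\<alpha> \<in> completion_uniformity S U"
    then obtain a where a: "a \<in> U" "cover_refines (?L ` a) \<alpha>"
      by (auto simp: completion_uniformity_def)
    then obtain b where b: "b \<in> U" "star_refines b a"
      using U unfolding covering_uniformity_def by meson
    have "star_refines (?L ` b) \<alpha>"
      unfolding star_refines_def
    proof
      fix A assume "A \<in> ?L ` b"
      then obtain B where B: "B \<in> b" "A = ?L B" by blast
      then obtain E where E: "E \<in> a" "cover_star B b \<subseteq> E"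
        using b unfolding star_refines_def by meson
      have "cover_star A (?L ` b) \<subseteq> ?L E"
      proof
        fix F assume "F \<in> cover_star A (?L ` b)"
        then obtain C F' where C: "C \<in> b" "F' \<in> ?L B" "F' \<in> ?L C" "F \<in> ?L C"
          using B by (auto simp: cover_star_def)
        then have "eventually (\<lambda>x. x \<in> B \<and> x \<in> C) F'" "F' \<noteq> bot"
          by (auto simp: completion_lift_def completion_points_def cauchy_filter_wrt_def
              intro: eventually_conj)
        then have "B \<inter> C \<noteq> {}" by (metis (no_types, lifting) IntI empty_iff eventually_happens)
        then have "C \<subseteq> E" using C E unfolding cover_star_def by blast
        then show "F \<in> ?L E" using mono C by blast
      qed
      then show "\<exists>A'\<in>\<alpha>. cover_star A (?L ` b) \<subseteq> A'"
        using a E unfolding cover_refines_def by (meson imageI subset_trans)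
    qed
    then show "\<exists>\<beta>\<in>completion_uniformity S U. star_refines \<beta> \<alpha>" using mem b by blast
  next
    fix F F' assume F: "F \<in> completion_points S U" "F' \<in> completion_points S U" "F \<noteq> F'"
    have "\<exists>\<gamma>\<in>U. \<not> (\<exists>E\<in>\<gamma>. eventually (\<lambda>x. x \<in> E) F \<and> eventually (\<lambda>x. x \<in> E) F')"
    proof (rule ccontr)
      assume "\<not> ?thesis"
      then have "cauchy_filter_wrt S U (sup F F')"
        using F unfolding completion_points_def cauchy_filter_wrt_def
        by (auto simp: eventually_sup)
      then have "sup F F' = F" "sup F F' = F'"
        using F unfolding completion_points_def by auto
      then show False using F by simp
    qed
    then obtain \<gamma> where \<gamma>: "\<gamma> \<in> U"
      "\<not> (\<exists>E\<in>\<gamma>. eventually (\<lambda>x. x \<in> E) F \<and> eventually (\<lambda>x. x \<in> E) F')" by blast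
    then have "\<not> (\<exists>E\<in>?L ` \<gamma>. F \<in> E \<and> F' \<in> E)" unfolding completion_lift_def by blast
    then show "\<exists>\<gamma>\<in>completion_uniformity S U. \<not> (\<exists>E\<in>\<gamma>. F \<in> E \<and> F' \<in> E)"
      using mem \<gamma> by blast
  qed
qed


section \<open>G-spaces and G-compactifications\<close>

definition Tychonoff_space :: "'a topology \<Rightarrow> bool" where
  "Tychonoff_space X \<longleftrightarrow> completely_regular_space X \<and> Hausdorff_space X"

definition topological_group :: "('g, 'm) monoid_scheme \<Rightarrow> 'g topology \<Rightarrow> bool" where
  "topological_group G T \<longleftrightarrow>
     group G \<and> topspace T = carrier G \<and> Tychonoff_space T \<and>
     continuous_map (prod_topology T T) T (\<lambda>(g, h). g \<otimes>\<^bsub>G\<^esub> h) \<and>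
     continuous_map T T (\<lambda>g. inv\<^bsub>G\<^esub> g)"

definition G_space ::
  "('g, 'm) monoid_scheme \<Rightarrow> 'g topology \<Rightarrow> 'x topology \<Rightarrow> ('g \<Rightarrow> 'x \<Rightarrow> 'x) \<Rightarrow> bool" where
  "G_space G T X \<phi> \<longleftrightarrow>
     Tychonoff_space X \<and> group_action G (topspace X) \<phi> \<and>
     continuous_map (prod_topology T X) X (\<lambda>(g, x). \<phi> g x)"

definition G_compactification ::
  "('g, 'm) monoid_scheme \<Rightarrow> 'g topology \<Rightarrow> 'x topology \<Rightarrow> ('g \<Rightarrow> 'x \<Rightarrow> 'x) \<Rightarrow>
   'b topology \<Rightarrow> ('g \<Rightarrow> 'b \<Rightarrow> 'b) \<Rightarrow> ('x \<Rightarrow> 'b) \<Rightarrow> bool" where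
  "G_compactification G T X \<phi> B \<psi> e \<longleftrightarrow>
     compact_space B \<and> G_space G T B \<psi> \<and>
     embedding_map X B e \<and> B closure_of (e ` topspace X) = topspace B \<and>
     (\<forall>g\<in>carrier G. \<forall>x\<in>topspace X. e (\<phi> g x) = \<psi> g (e x))"

text \<open>The ordering of G-compactifications \<open>(B, \<psi>, e) \<ge> (B', \<psi>', e')\<close>.\<close>

definition G_compactification_ge ::
  "('g, 'm) monoid_scheme \<Rightarrow> 'x topology \<Rightarrow>
   'b topology \<Rightarrow> ('g \<Rightarrow> 'b \<Rightarrow> 'b) \<Rightarrow> ('x \<Rightarrow> 'b) \<Rightarrow>
   'c topology \<Rightarrow> ('g \<Rightarrow> 'c \<Rightarrow> 'c) \<Rightarrow> ('x \<Rightarrow> 'c) \<Rightarrow> bool" where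
  "G_compactification_ge G X B \<psi> e B' \<psi>' e' \<longleftrightarrow>
     (\<exists>f. continuous_map B B' f \<and>
          (\<forall>g\<in>carrier G. \<forall>b\<in>topspace B. f (\<psi> g b) = \<psi>' g (f b)) \<and>
          (\<forall>x\<in>topspace X. f (e x) = e' x))"

text \<open>
  A formula of HOL cannot quantify over types, so the type of the points of the compactifications
  to be dominated is a parameter. With \<open>'c\<close> a free type variable of a theorem, they range over
  all types.
\<close>

definition maximal_G_compactification ::
  "'c itself \<Rightarrow> ('g, 'm) monoid_scheme \<Rightarrow> 'g topology \<Rightarrow> 'x topology \<Rightarrow> ('g \<Rightarrow> 'x \<Rightarrow> 'x) \<Rightarrow>
   'b topology \<Rightarrow> ('g \<Rightarrow> 'b \<Rightarrow> 'b) \<Rightarrow> ('x \<Rightarrow> 'b) \<Rightarrow> bool" where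
  "maximal_G_compactification TYPE('c) G T X \<phi> B \<psi> e \<longleftrightarrow>
     G_compactification G T X \<phi> B \<psi> e \<and>
     (\<forall>(B' :: 'c topology) \<psi>' e'. G_compactification G T X \<phi> B' \<psi>' e' \<longrightarrow>
        G_compactification_ge G X B \<psi> e B' \<psi>' e')"

definition orbit_closure_cover ::
  "'x topology \<Rightarrow> ('g \<Rightarrow> 'x \<Rightarrow> 'x) \<Rightarrow> 'g set \<Rightarrow> 'x set set" where
  "orbit_closure_cover X \<phi> N = {X closure_of ((\<lambda>g. \<phi> g x) ` N) |x. x \<in> topspace X}"

definition orbit_closure_uniformity ::
  "('g, 'm) monoid_scheme \<Rightarrow> 'g topology \<Rightarrow> 'x topology \<Rightarrow> ('g \<Rightarrow> 'x \<Rightarrow> 'x) \<Rightarrow> 'x set set set" where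
  "orbit_closure_uniformity G T X \<phi> =
     {\<alpha>. covering_of (topspace X) \<alpha> \<and>
          (\<exists>N. openin T N \<and> \<one>\<^bsub>G\<^esub> \<in> N \<and> cover_refines (orbit_closure_cover X \<phi> N) \<alpha>)}"

end

theory Submission
  imports Defs
begin

text \<open>
  In a totally bounded covering uniformity the sets \<open>{\<xi>. A \<in> \<xi>}\<close> form a base of the completion,
  which is compact Hausdorff. Translations by group elements preserve \<open>U\<^sub>G\<close>, because conjugation
  permutes the neighbourhoods of the identity, so they act on the Samuel compactification by
  pushing filters forward. Joint continuity holds because, by the definition of \<open>U\<^sub>G\<close>, elements near
  the identity move points by less than any given cover. Conversely, an equivariant map \<open>e\<close> into a
  compact \<open>G\<close>-space is uniformly continuous for \<open>U\<^sub>G\<close>: compactness yields one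
  neighbourhood of the identity that moves all points little. Hence \<open>e\<close> has a limit along every point of
  the Samuel compactification, and this extension is equivariant by uniqueness of limits.
\<close>

section \<open>Completions of covering uniformities\<close>

text \<open>Pushing filters forward or collecting points along an ultrafilter yields Cauchy filters,
  whereas the completion admits only minimal ones. The bridge is the envelope: the stars of a Cauchy
  filter generate the unique minimal Cauchy filter contained in it. Points are therefore round, that
  is, every member of a point contains a star of that point, and this makes the lift of an arbitrary
  set open, not only the lift of an open one.

  The Samuel uniformity is the totally bounded part \<open>\<P>\<close> of \<open>\<U>\<close>.
  Finite covers are what the ultrafilter argument for compactness needs; inclusion in
  \<open>\<U>\<close> is what supplies a neighbourhood of the identity for each cover in
  \<open>\<P>\<close>; and both families induce the same topology, so compatibility passes to
  \<open>\<P>\<close>.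

  The basic covers of \<open>\<U>\<close> consist of closures. A map into a compact G-space must
  therefore send a whole closure into one element of a given cover, and so open sets of the target
  are first shrunk to closed ones by regularity.\<close>

definition filter_star :: "'a filter \<Rightarrow> 'a set set \<Rightarrow> 'a set" where
  "filter_star F \<alpha> = \<Union>{E\<in>\<alpha>. eventually (\<lambda>x. x \<in> E) F}"

lemma filter_starI: "E \<in> \<alpha> \<Longrightarrow> eventually (\<lambda>x. x \<in> E) F \<Longrightarrow> E \<subseteq> filter_star F \<alpha>"
  unfolding filter_star_def by blast

lemma filter_star_least:
  "(\<And>E. E \<in> \<alpha> \<Longrightarrow> eventually (\<lambda>x. x \<in> E) F \<Longrightarrow> E \<subseteq> A) \<Longrightarrow> filter_star F \<alpha> \<subseteq> A"
  unfolding filter_star_def by blast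

lemma eventually_superset:
  "eventually (\<lambda>x. x \<in> A) F \<Longrightarrow> A \<subseteq> B \<Longrightarrow> eventually (\<lambda>x. x \<in> B) F"
  by (erule eventually_mono) blast

lemma filter_star_refines:
  assumes "cover_refines \<alpha> \<beta>"
  shows "filter_star F \<alpha> \<subseteq> filter_star F \<beta>"
proof (rule filter_star_least)
  fix E assume E: "E \<in> \<alpha>" "eventually (\<lambda>x. x \<in> E) F"
  then obtain B where B: "B \<in> \<beta>" "E \<subseteq> B" using assms unfolding cover_refines_def by blast
  show "E \<subseteq> filter_star F \<beta>"
    using filter_starI[OF B(1) eventually_superset[OF E(2) B(2)]] B(2) by blast
qed

lemma filter_star_antimono:
  "F \<le> F' \<Longrightarrow> filter_star F' \<alpha> \<subseteq> filter_star F \<alpha>"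
  unfolding filter_star_def using filter_leD[of F F'] by blast

lemma filter_star_principal: "filter_star (principal {x}) \<alpha> = cover_star {x} \<alpha>"
  by (simp add: filter_star_def cover_star_singleton eventually_principal)

lemma star_subset_of_common_element:
  assumes "star_refines \<beta> \<alpha>" "E \<in> \<beta>"
  obtains A where "A \<in> \<alpha>" "\<And>C. C \<in> \<beta> \<Longrightarrow> C \<inter> E \<noteq> {} \<Longrightarrow> C \<subseteq> A" "E \<subseteq> A"
proof -
  obtain A where A: "A \<in> \<alpha>" "cover_star E \<beta> \<subseteq> A"
    using assms unfolding star_refines_def by blast
  show ?thesis
  proof
    show "A \<in> \<alpha>" by fact
    show "C \<subseteq> A" if "C \<in> \<beta>" "C \<inter> E \<noteq> {}" for C
      using that A unfolding cover_star_def by blast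
    show "E \<subseteq> A" using A assms(2) unfolding cover_star_def by blast
  qed
qed

lemma eventually_meet:
  assumes "F \<noteq> bot" "eventually (\<lambda>x. x \<in> A) F" "eventually (\<lambda>x. x \<in> B) F"
  shows "A \<inter> B \<noteq> {}"
  using eventually_happens'[OF assms(1) eventually_conj[OF assms(2,3)]] by blast

section \<open>Envelopes of Cauchy filters and round filters\<close>

locale covering_uniform_space =
  fixes S :: "'a set" and U :: "'a set set set"
  assumes uniformity: "covering_uniformity S U"
    and nonempty: "U \<noteq> {}"
begin

lemmas uniformity_axioms = uniformity[unfolded covering_uniformity_def]

lemma Union_member: "\<alpha> \<in> U \<Longrightarrow> \<Union>\<alpha> = S"
  using uniformity_axioms[THEN conjunct1] unfolding covering_of_def by blast

lemma refined_by_member: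
  "\<alpha> \<in> U \<Longrightarrow> covering_of S \<beta> \<Longrightarrow> cover_refines \<alpha> \<beta> \<Longrightarrow> \<beta> \<in> U"
  using uniformity_axioms[THEN conjunct2, THEN conjunct1] by blast

lemma common_refinement:
  assumes "\<alpha> \<in> U" "\<beta> \<in> U"
  obtains \<gamma> where "\<gamma> \<in> U" "cover_refines \<gamma> \<alpha>" "cover_refines \<gamma> \<beta>"
  using uniformity_axioms[THEN conjunct2, THEN conjunct2, THEN conjunct1] assms by blast

lemma star_refinement:
  assumes "\<alpha> \<in> U"
  obtains \<beta> where "\<beta> \<in> U" "star_refines \<beta> \<alpha>"
  using uniformity_axioms[THEN conjunct2, THEN conjunct2, THEN conjunct2, THEN conjunct1] assms
  by blast

lemma separated:
  assumes "x \<in> S" "y \<in> S" "x \<noteq> y"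
  obtains \<gamma> where "\<gamma> \<in> U" "\<not> (\<exists>E\<in>\<gamma>. x \<in> E \<and> y \<in> E)"
  using uniformity_axioms[THEN conjunct2, THEN conjunct2, THEN conjunct2, THEN conjunct2] assms
  by blast

text \<open>The filter generated by the stars of \<open>F\<close>. For a Cauchy filter this is the
  coarsest Cauchy filter above it in the order \<open>\<le>\<close>, hence the minimal one as a
  family of sets.\<close>

definition envelope :: "'a filter \<Rightarrow> 'a filter" where
  "envelope F = Abs_filter (\<lambda>P. \<exists>\<gamma>\<in>U. filter_star F \<gamma> \<subseteq> Collect P)"

lemma eventually_envelope:
  "eventually P (envelope F) \<longleftrightarrow> (\<exists>\<gamma>\<in>U. filter_star F \<gamma> \<subseteq> Collect P)"
  unfolding envelope_def
proof (rule eventually_Abs_filter, rule is_filter.intro)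
  show "\<exists>\<gamma>\<in>U. filter_star F \<gamma> \<subseteq> Collect (\<lambda>x. True)"
    using nonempty by auto
next
  fix P Q :: "'a \<Rightarrow> bool"
  assume "\<exists>\<gamma>\<in>U. filter_star F \<gamma> \<subseteq> Collect P" "\<exists>\<gamma>\<in>U. filter_star F \<gamma> \<subseteq> Collect Q"
  then obtain \<alpha> \<beta> where a: "\<alpha> \<in> U" "filter_star F \<alpha> \<subseteq> Collect P"
    and b: "\<beta> \<in> U" "filter_star F \<beta> \<subseteq> Collect Q" by blast
  obtain \<gamma> where "\<gamma> \<in> U" "cover_refines \<gamma> \<alpha>" "cover_refines \<gamma> \<beta>"
    using common_refinement[OF a(1) b(1)] .
  then show "\<exists>\<gamma>\<in>U. filter_star F \<gamma> \<subseteq> Collect (\<lambda>x. P x \<and> Q x)"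
    using filter_star_refines[of \<gamma> \<alpha> F] filter_star_refines[of \<gamma> \<beta> F] a(2) b(2) by blast
qed auto

lemma cauchy_member:
  assumes "cauchy_filter_wrt S U F" "\<gamma> \<in> U"
  obtains E where "E \<in> \<gamma>" "eventually (\<lambda>x. x \<in> E) F"
  using assms unfolding cauchy_filter_wrt_def by blast

lemma cauchy_not_bot: "cauchy_filter_wrt S U F \<Longrightarrow> F \<noteq> bot"
  by (simp add: cauchy_filter_wrt_def)

lemma cauchy_eventually_filter_star:
  assumes "cauchy_filter_wrt S U F" "\<gamma> \<in> U"
  shows "eventually (\<lambda>x. x \<in> filter_star F \<gamma>) F"
  using cauchy_member[OF assms] filter_starI eventually_superset by metis

lemma cauchy_le_envelope:
  assumes F: "cauchy_filter_wrt S U F"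
  shows "F \<le> envelope F"
proof (rule filter_leI)
  fix P assume "eventually P (envelope F)"
  then obtain \<gamma> where g: "\<gamma> \<in> U" "filter_star F \<gamma> \<subseteq> Collect P"
    by (auto simp: eventually_envelope)
  show "eventually P F"
    using eventually_superset[OF cauchy_eventually_filter_star[OF F g(1)] g(2)] by simp
qed

text \<open>Fix one member \<open>E\<close> of the cover that belongs to \<open>F\<close>. As
  \<open>F\<close> is proper, every other member belonging to \<open>F\<close> meets
  \<open>E\<close>, so all of them lie in the star of \<open>E\<close>, which star refinement puts
  inside a single set.\<close>

lemma filter_star_subset_member:
  assumes F: "cauchy_filter_wrt S U F" and b: "\<beta> \<in> U" "star_refines \<beta> \<alpha>"
  obtains A where "A \<in> \<alpha>" "filter_star F \<beta> \<subseteq> A"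
proof -
  obtain E where E: "E \<in> \<beta>" "eventually (\<lambda>x. x \<in> E) F" using cauchy_member[OF F b(1)] .
  obtain A where A: "A \<in> \<alpha>" "\<And>C. C \<in> \<beta> \<Longrightarrow> C \<inter> E \<noteq> {} \<Longrightarrow> C \<subseteq> A"
    using star_subset_of_common_element[OF b(2) E(1)] by metis
  have "filter_star F \<beta> \<subseteq> A"
    using A(2) eventually_meet[OF cauchy_not_bot[OF F] _ E(2)] by (intro filter_star_least) blast
  then show ?thesis using that A(1) by blast
qed

lemma envelope_cauchy:
  assumes F: "cauchy_filter_wrt S U F"
  shows "cauchy_filter_wrt S U (envelope F)"
  unfolding cauchy_filter_wrt_def
proof (intro conjI ballI)
  show "envelope F \<noteq> bot"
    using cauchy_le_envelope[OF F] cauchy_not_bot[OF F] by (metis bot.extremum_uniqueI)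
  obtain \<gamma> where g: "\<gamma> \<in> U" using nonempty by blast
  have "filter_star F \<gamma> \<subseteq> S" using Union_member[OF g] by (intro filter_star_least) blast
  then show "envelope F \<le> principal S"
    unfolding le_principal eventually_envelope using g by auto
  fix \<alpha> assume "\<alpha> \<in> U"
  then obtain \<beta> where b: "\<beta> \<in> U" "star_refines \<beta> \<alpha>" using star_refinement by blast
  then obtain A where "A \<in> \<alpha>" "filter_star F \<beta> \<subseteq> A" using filter_star_subset_member[OF F] by blast
  then show "\<exists>E\<in>\<alpha>. eventually (\<lambda>x. x \<in> E) (envelope F)"
    using b unfolding eventually_envelope by auto
qed

text \<open>A coarser filter selects fewer elements of a cover, so its stars are smaller. Being
  Cauchy, \<open>F'\<close> contains its own stars and hence also the larger stars of
  \<open>F\<close>.\<close>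

lemma envelope_greatest:
  assumes F': "cauchy_filter_wrt S U F'" and le: "F \<le> F'"
  shows "F' \<le> envelope F"
proof (rule filter_leI)
  fix P assume "eventually P (envelope F)"
  then obtain \<gamma> where g: "\<gamma> \<in> U" "filter_star F \<gamma> \<subseteq> Collect P"
    by (auto simp: eventually_envelope)
  then have "filter_star F' \<gamma> \<subseteq> Collect P" using filter_star_antimono[OF le] by blast
  then show "eventually P F'"
    using eventually_superset[OF cauchy_eventually_filter_star[OF F' g(1)], of "Collect P"]
    by simp
qed

lemma envelope_point:
  assumes F: "cauchy_filter_wrt S U F"
  shows "envelope F \<in> completion_points S U"
  unfolding completion_points_def
  using envelope_cauchy[OF F] envelope_greatest cauchy_le_envelope[OF F]
  by (auto intro: antisym)

lemma pointD:
  assumes "\<xi> \<in> completion_points S U"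
  shows "cauchy_filter_wrt S U \<xi>" "\<xi> \<noteq> bot" "\<xi> \<le> principal S"
    "eventually (\<lambda>x. x \<in> S) \<xi>"
  using assms by (auto simp: completion_points_def cauchy_filter_wrt_def le_principal)

lemma point_member:
  assumes "\<xi> \<in> completion_points S U" "\<gamma> \<in> U"
  obtains E where "E \<in> \<gamma>" "eventually (\<lambda>x. x \<in> E) \<xi>"
  using assms pointD(1)[OF assms(1)] by (auto simp: cauchy_filter_wrt_def)

lemma envelope_of_point: 
  assumes "\<xi> \<in> completion_points S U"
  shows "envelope \<xi> = \<xi>"
  using assms envelope_cauchy[OF pointD(1)[OF assms]] cauchy_le_envelope[OF pointD(1)[OF assms]]
  by (auto simp: completion_points_def)

text \<open>Roundness: a point equals its envelope, so each of its members already contains one of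
  the generating stars.\<close>

lemma point_round:
  assumes "\<xi> \<in> completion_points S U" "eventually (\<lambda>x. x \<in> A) \<xi>"
  obtains \<gamma> where "\<gamma> \<in> U" "filter_star \<xi> \<gamma> \<subseteq> A"
  using assms(2) eventually_envelope[of "\<lambda>x. x \<in> A" \<xi>]
  unfolding envelope_of_point[OF assms(1)] by auto

text \<open>One further star refinement leaves a margin: anything that is \<beta>-close to
  \<open>E\<close> is still in \<open>A\<close>. Density and joint continuity both rely on this
  margin.\<close>

lemma point_star_round:
  assumes \<xi>: "\<xi> \<in> completion_points S U" "eventually (\<lambda>x. x \<in> A) \<xi>"
  obtains \<beta> E where "\<beta> \<in> U" "E \<in> \<beta>" "eventually (\<lambda>x. x \<in> E) \<xi>"
    "\<forall>C\<in>\<beta>. C \<inter> E \<noteq> {} \<longrightarrow> C \<subseteq> A"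
proof -
  obtain \<gamma> where g: "\<gamma> \<in> U" "filter_star \<xi> \<gamma> \<subseteq> A"
    using point_round[OF \<xi>] .
  obtain \<beta> where b: "\<beta> \<in> U" "star_refines \<beta> \<gamma>" using star_refinement[OF g(1)] .
  obtain E where E: "E \<in> \<beta>" "eventually (\<lambda>x. x \<in> E) \<xi>"
    using point_member[OF \<xi>(1) b(1)] .
  obtain B where B: "B \<in> \<gamma>" "\<And>C. C \<in> \<beta> \<Longrightarrow> C \<inter> E \<noteq> {} \<Longrightarrow> C \<subseteq> B" "E \<subseteq> B"
    using star_subset_of_common_element[OF b(2) E(1)] by metis
  have "B \<subseteq> A" using filter_starI[OF B(1) eventually_superset[OF E(2) B(3)]] g(2) by blast
  then show ?thesis using that[OF b(1) E] B(2) by blast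
qed

section \<open>The topology of the completion\<close>

lemma completion_lift_mono: "A \<subseteq> B \<Longrightarrow> completion_lift S U A \<subseteq> completion_lift S U B"
  unfolding completion_lift_def by (auto elim: eventually_mono)

lemma completion_lift_Int:
  "completion_lift S U A \<inter> completion_lift S U B = completion_lift S U (A \<inter> B)"
  unfolding completion_lift_def by (auto simp: eventually_conj_iff)

lemma completion_lift_empty [simp]: "completion_lift S U {} = {}"
  unfolding completion_lift_def using pointD(2) by auto

lemma Union_completion_lift:
  "\<gamma> \<in> U \<Longrightarrow> \<Union>(completion_lift S U ` \<gamma>) = completion_points S U"
  unfolding completion_lift_def using point_member by blast

lemma completion_lift_in_uniformity:
  "\<gamma> \<in> U \<Longrightarrow> completion_lift S U ` \<gamma> \<in> completion_uniformity S U"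
  using Union_completion_lift
  unfolding completion_uniformity_def covering_of_def cover_refines_def by blast

abbreviation completion_topology :: "'a filter topology" where
  "completion_topology \<equiv> uniform_topology (completion_points S U) (completion_uniformity S U)"

lemmas openin_completion =
  openin_uniform_topology[OF covering_uniformity_completion[OF uniformity]]

text \<open>\<open>A\<close> may be any set. If a star of \<xi> lies in \<open>A\<close>, then every
  element of that cover whose lift contains \<xi> lies in \<open>A\<close>, so the star of \<xi> in
  the completion stays in the lift of \<open>A\<close>.\<close>

lemma openin_completion_lift: "openin completion_topology (completion_lift S U A)"
  unfolding openin_completion
proof (intro conjI ballI)
  show "completion_lift S U A \<subseteq> completion_points S U" by (auto simp: completion_lift_def)
  fix \<xi> assume "\<xi> \<in> completion_lift S U A"
  then have \<xi>: "\<xi> \<in> completion_points S U" "eventually (\<lambda>x. x \<in> A) \<xi>"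
    by (auto simp: completion_lift_def)
  obtain \<gamma> where g: "\<gamma> \<in> U" "filter_star \<xi> \<gamma> \<subseteq> A" using point_round[OF \<xi>] .
  have "cover_star {\<xi>} (completion_lift S U ` \<gamma>) \<subseteq> completion_lift S U A"
  proof
    fix \<zeta> assume "\<zeta> \<in> cover_star {\<xi>} (completion_lift S U ` \<gamma>)"
    then obtain E where E: "E \<in> \<gamma>" "\<xi> \<in> completion_lift S U E" "\<zeta> \<in> completion_lift S U E"
      by (auto simp: cover_star_singleton)
    then have "E \<subseteq> A"
      using filter_starI[OF E(1)] g(2) unfolding completion_lift_def by blast
    then show "\<zeta> \<in> completion_lift S U A" using completion_lift_mono E by blast
  qed
  then show "\<exists>\<gamma>\<in>completion_uniformity S U. cover_star {\<xi>} \<gamma> \<subseteq> completion_lift S U A"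
    using completion_lift_in_uniformity[OF g(1)] by blast
qed

lemma openin_completionD:
  assumes "openin completion_topology V" "\<xi> \<in> V"
  obtains A where "\<xi> \<in> completion_lift S U A" "completion_lift S U A \<subseteq> V"
proof -
  have \<xi>: "\<xi> \<in> completion_points S U" using assms openin_completion by blast
  obtain \<alpha> where a: "\<alpha> \<in> completion_uniformity S U" "cover_star {\<xi>} \<alpha> \<subseteq> V"
    using assms openin_completion by blast
  then obtain \<gamma> where g: "\<gamma> \<in> U" "cover_refines (completion_lift S U ` \<gamma>) \<alpha>"
    by (auto simp: completion_uniformity_def)
  obtain E where E: "E \<in> \<gamma>" "eventually (\<lambda>x. x \<in> E) \<xi>" using point_member[OF \<xi> g(1)] .
  then have mem: "\<xi> \<in> completion_lift S U E" using \<xi> by (simp add: completion_lift_def)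
  moreover obtain B where "B \<in> \<alpha>" "completion_lift S U E \<subseteq> B"
    using g(2) E(1) unfolding cover_refines_def by blast
  ultimately show ?thesis using that a(2) unfolding cover_star_singleton by blast
qed

lemma completion_lift_S: "completion_lift S U S = completion_points S U"
  unfolding completion_lift_def using pointD(4) by auto

lemma topspace_completion: "topspace completion_topology = completion_points S U"
  by (metis (no_types, lifting) completion_lift_S openin_completion openin_completion_lift
      openin_subset openin_topspace subset_antisym)

text \<open>The separation axiom only says that two points share no element of some cover. Star
  refinement turns this into disjointness: if neighbourhoods \<open>E\<close> and \<open>D\<close>
  taken from the finer cover met, one element of the coarser cover would contain both.\<close>

lemma Hausdorff_completion: "Hausdorff_space completion_topology"
  unfolding Hausdorff_space_def topspace_completion
proof (intro allI impI, elim conjE)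
  fix \<xi> \<zeta> assume \<xi>: "\<xi> \<in> completion_points S U" and \<zeta>: "\<zeta> \<in> completion_points S U"
    and ne: "\<xi> \<noteq> \<zeta>"
  then obtain \<alpha> where a: "\<alpha> \<in> completion_uniformity S U" "\<not> (\<exists>E\<in>\<alpha>. \<xi> \<in> E \<and> \<zeta> \<in> E)"
    using covering_uniformity_completion[OF uniformity, unfolded covering_uniformity_def,
        THEN conjunct2, THEN conjunct2, THEN conjunct2, THEN conjunct2] by blast
  then obtain \<gamma> where g: "\<gamma> \<in> U" "cover_refines (completion_lift S U ` \<gamma>) \<alpha>"
    by (auto simp: completion_uniformity_def)
  obtain \<beta> where b: "\<beta> \<in> U" "star_refines \<beta> \<gamma>" using star_refinement[OF g(1)] .
  obtain E where E: "E \<in> \<beta>" "eventually (\<lambda>x. x \<in> E) \<xi>" using point_member[OF \<xi> b(1)] .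
  obtain D where D: "D \<in> \<beta>" "eventually (\<lambda>x. x \<in> D) \<zeta>" using point_member[OF \<zeta> b(1)] .
  obtain A where A: "A \<in> \<gamma>" "\<And>C. C \<in> \<beta> \<Longrightarrow> C \<inter> E \<noteq> {} \<Longrightarrow> C \<subseteq> A" "E \<subseteq> A"
    using star_subset_of_common_element[OF b(2) E(1)] by metis
  have "E \<inter> D = {}"
  proof (rule ccontr)
    assume "E \<inter> D \<noteq> {}"
    then have "D \<subseteq> A" using A(2) D(1) by blast
    then have "\<xi> \<in> completion_lift S U A" "\<zeta> \<in> completion_lift S U A"
      using E D A(3) \<xi> \<zeta> unfolding completion_lift_def by (auto elim: eventually_mono)
    moreover obtain B where "B \<in> \<alpha>" "completion_lift S U A \<subseteq> B"
      using g(2) A(1) unfolding cover_refines_def by blast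
    ultimately show False using a(2) by blast
  qed
  then have "disjnt (completion_lift S U E) (completion_lift S U D)"
    by (simp add: disjnt_def completion_lift_Int)
  moreover have "\<xi> \<in> completion_lift S U E" "\<zeta> \<in> completion_lift S U D"
    using E D \<xi> \<zeta> by (auto simp: completion_lift_def)
  ultimately show "\<exists>V W. openin completion_topology V \<and> openin completion_topology W \<and>
      \<xi> \<in> V \<and> \<zeta> \<in> W \<and> disjnt V W"
    using openin_completion_lift by blast
qed

section \<open>The embedding into the completion\<close>

lemma topspace_uniform: "topspace (uniform_topology S U) = S"
proof
  show "topspace (uniform_topology S U) \<subseteq> S"
    using openin_topspace openin_uniform_topology[OF uniformity] by blast
  have "openin (uniform_topology S U) S"
    unfolding openin_uniform_topology[OF uniformity] cover_star_def
    using nonempty Union_member by blast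
  then show "S \<subseteq> topspace (uniform_topology S U)" by (rule openin_subset)
qed

lemma eventually_nhdsin_uniform:
  assumes x: "x \<in> S"
  shows "eventually P (nhdsin (uniform_topology S U) x) \<longleftrightarrow>
           (\<exists>\<gamma>\<in>U. \<forall>y\<in>cover_star {x} \<gamma>. P y)"
proof
  assume "eventually P (nhdsin (uniform_topology S U) x)"
  moreover have "x \<in> topspace (uniform_topology S U)" using x by (simp add: topspace_uniform)
  ultimately show "\<exists>\<gamma>\<in>U. \<forall>y\<in>cover_star {x} \<gamma>. P y"
    unfolding eventually_nhdsin openin_uniform_topology[OF uniformity] by blast
next
  assume "\<exists>\<gamma>\<in>U. \<forall>y\<in>cover_star {x} \<gamma>. P y"
  then obtain \<gamma> where g: "\<gamma> \<in> U" "\<forall>y\<in>cover_star {x} \<gamma>. P y" by blast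
  \<comment> \<open>\<open>W\<close> is the interior of \<open>P\<close>. It is open because, for
    \<open>z\<close> in the \<delta>-star of \<open>y\<close>, the entire \<delta>-star of
    \<open>z\<close> lies in a single element of \<beta> that contains \<open>y\<close>.\<close>
  define W where "W = {y\<in>S. \<exists>\<beta>\<in>U. \<forall>z\<in>cover_star {y} \<beta>. P z}"
  have in_star: "y \<in> cover_star {y} \<beta>" if "y \<in> S" "\<beta> \<in> U" for y \<beta>
    using that Union_member unfolding cover_star_singleton by blast
  have "openin (uniform_topology S U) W"
    unfolding openin_uniform_topology[OF uniformity]
  proof (intro conjI ballI)
    show "W \<subseteq> S" by (auto simp: W_def)
    fix y assume y: "y \<in> W"
    then obtain \<beta> where b: "\<beta> \<in> U" "\<forall>z\<in>cover_star {y} \<beta>. P z" by (auto simp: W_def)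
    obtain \<delta> where d: "\<delta> \<in> U" "star_refines \<delta> \<beta>" using star_refinement[OF b(1)] .
    have "z \<in> W" if z: "z \<in> cover_star {y} \<delta>" for z
    proof -
      obtain E where E: "E \<in> \<delta>" "y \<in> E" "z \<in> E"
        using z by (auto simp: cover_star_singleton)
      obtain A where A: "A \<in> \<beta>" "\<And>C. C \<in> \<delta> \<Longrightarrow> C \<inter> E \<noteq> {} \<Longrightarrow> C \<subseteq> A" "E \<subseteq> A"
        using star_subset_of_common_element[OF d(2) E(1)] by metis
      have "cover_star {z} \<delta> \<subseteq> A" using A(2) E(3) unfolding cover_star_singleton by blast
      moreover have "A \<subseteq> cover_star {y} \<beta>" using A E unfolding cover_star_singleton by blast
      moreover have "z \<in> S" using Union_member[OF d(1)] E by blast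
      ultimately show ?thesis using b(2) d(1) unfolding W_def by blast
    qed
    then show "\<exists>\<gamma>\<in>U. cover_star {y} \<gamma> \<subseteq> W" using d(1) by blast
  qed
  moreover have "x \<in> W" using x g by (auto simp: W_def)
  moreover have "\<forall>y\<in>W. P y" using in_star by (auto simp: W_def)
  ultimately show "eventually P (nhdsin (uniform_topology S U) x)"
    unfolding eventually_nhdsin by blast
qed

text \<open>This identifies the neighbourhood filter as the minimal Cauchy filter contained in the
  principal one, so that the general results on envelopes show it to be a point.\<close>

lemma completion_map_eq_envelope:
  assumes "x \<in> S"
  shows "completion_map S U x = envelope (principal {x})"
  by (rule filter_eqI)
    (auto simp: completion_map_def eventually_nhdsin_uniform[OF assms] eventually_envelope
      filter_star_principal)

lemma completion_map_point:
  assumes "x \<in> S"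
  shows "completion_map S U x \<in> completion_points S U"
proof -
  have "\<exists>E\<in>\<gamma>. x \<in> E" if "\<gamma> \<in> U" for \<gamma>
    using Union_member[OF that] assms by blast
  then have "cauchy_filter_wrt S U (principal {x})"
    using assms by (simp add: cauchy_filter_wrt_def eventually_principal principal_eq_bot_iff)
  then show ?thesis using envelope_point completion_map_eq_envelope[OF assms] by simp
qed

lemma completion_map_in_lift:
  assumes "x \<in> S"
  shows "completion_map S U x \<in> completion_lift S U A \<longleftrightarrow>
           (\<exists>W. openin (uniform_topology S U) W \<and> x \<in> W \<and> W \<subseteq> A)"
  using completion_map_point[OF assms] assms
  by (auto simp: completion_lift_def completion_map_def eventually_nhdsin topspace_uniform)

lemma completion_map_in_open_lift:
  assumes "openin (uniform_topology S U) W" "x \<in> S"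
  shows "completion_map S U x \<in> completion_lift S U W \<longleftrightarrow> x \<in> W"
  using completion_map_in_lift[OF assms(2)] assms(1) by blast

lemma embedding_completion_map:
  "embedding_map (uniform_topology S U) completion_topology (completion_map S U)"
  unfolding embedding_map_def topspace_uniform
proof (rule bijective_open_imp_homeomorphic_map)
  let ?e = "completion_map S U"
  have sub: "?e ` S \<subseteq> topspace completion_topology"
    using completion_map_point by (auto simp: topspace_completion)
  have "continuous_map (uniform_topology S U) completion_topology ?e"
    unfolding continuous_map_def topspace_uniform
  proof (intro conjI allI impI)
    show "?e \<in> S \<rightarrow> topspace completion_topology" using sub by blast
    fix V assume V: "openin completion_topology V"
    show "openin (uniform_topology S U) {x \<in> S. ?e x \<in> V}"
    proof (subst openin_subopen, intro ballI)
      fix x assume x: "x \<in> {x \<in> S. ?e x \<in> V}"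
      then obtain A where A: "?e x \<in> completion_lift S U A" "completion_lift S U A \<subseteq> V"
        using openin_completionD[OF V] by blast
      have "\<exists>W. openin (uniform_topology S U) W \<and> x \<in> W \<and> W \<subseteq> A"
        using completion_map_in_lift[of x A] x A(1) by simp
      then obtain W where W: "openin (uniform_topology S U) W" "x \<in> W" "W \<subseteq> A"
        by blast
      have "W \<subseteq> S" using W(1) openin_subset topspace_uniform by metis
      then have "?e y \<in> completion_lift S U A" if "y \<in> W" for y
        using W \<open>W \<subseteq> S\<close> that by (intro completion_map_in_lift[THEN iffD2] exI[of _ W]) auto
      then have "W \<subseteq> {x \<in> S. ?e x \<in> V}" using A(2) \<open>W \<subseteq> S\<close> by blast
      then show "\<exists>T. openin (uniform_topology S U) T \<and> x \<in> T \<and> T \<subseteq> {x \<in> S. ?e x \<in> V}"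
        using W by blast
    qed
  qed
  then show "continuous_map (uniform_topology S U) (subtopology completion_topology (?e ` S)) ?e"
    by (auto simp: continuous_map_in_subtopology topspace_uniform)
  show "open_map (uniform_topology S U) (subtopology completion_topology (?e ` S)) ?e"
    unfolding open_map_def
  proof (intro allI impI)
    fix W assume W: "openin (uniform_topology S U) W"
    then have "W \<subseteq> S" using openin_subset topspace_uniform by metis
    \<comment> \<open>An open set is recovered as the trace of its lift on the image; this is the
      openness half of the embedding.\<close>
    then have "?e ` W = completion_lift S U W \<inter> ?e ` S"
      using completion_map_in_open_lift[OF W] by auto
    then show "openin (subtopology completion_topology (?e ` S)) (?e ` W)"
      using openin_completion_lift openin_subtopology by blast
  qed
  show "?e ` topspace (uniform_topology S U) = topspace (subtopology completion_topology (?e ` S))"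
    using sub by (auto simp: topspace_uniform)
  show "inj_on ?e (topspace (uniform_topology S U))"
    unfolding topspace_uniform
  proof (rule inj_onI, rule ccontr)
    fix x y assume xy: "x \<in> S" "y \<in> S" "?e x = ?e y" "x \<noteq> y"
    then obtain \<gamma> where g: "\<gamma> \<in> U" "\<not> (\<exists>E\<in>\<gamma>. x \<in> E \<and> y \<in> E)"
      using separated by blast
    \<comment> \<open>The \<gamma>-star of \<open>x\<close> omits \<open>y\<close>, so the
      complement of \<open>y\<close> is a neighbourhood of \<open>x\<close>; it cannot be one of
      \<open>y\<close>.\<close>
    have "eventually (\<lambda>z. z \<noteq> y) (?e x)"
      using g unfolding completion_map_def eventually_nhdsin_uniform[OF xy(1)] cover_star_singleton
      by blast
    then have "eventually (\<lambda>z. z \<noteq> y) (?e y)" using xy by simp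
    then show False using xy(2)
      by (auto simp: completion_map_def eventually_nhdsin topspace_uniform)
  qed
qed

lemma dense_completion_map:
  "completion_topology closure_of (completion_map S U ` S) = topspace completion_topology"
proof (rule subset_antisym[OF closure_of_subset_topspace], rule subsetI)
  fix \<xi> assume \<xi>: "\<xi> \<in> topspace completion_topology"
  show "\<xi> \<in> completion_topology closure_of (completion_map S U ` S)"
    unfolding in_closure_of
  proof (intro conjI allI impI \<xi>, elim conjE)
    fix V assume V: "\<xi> \<in> V" "openin completion_topology V"
    obtain A where A: "\<xi> \<in> completion_lift S U A" "completion_lift S U A \<subseteq> V"
      using openin_completionD[OF V(2,1)] .
    then have "\<xi> \<in> completion_points S U" "eventually (\<lambda>x. x \<in> A) \<xi>"
      by (auto simp: completion_lift_def)
    then obtain \<beta> E where b: "\<beta> \<in> U" "E \<in> \<beta>" "eventually (\<lambda>x. x \<in> E) \<xi>"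
      "\<forall>C\<in>\<beta>. C \<inter> E \<noteq> {} \<longrightarrow> C \<subseteq> A"
      \<comment> \<open>A point of \<open>A\<close> itself would not do, as \<open>A\<close> need
        not be a neighbourhood of it. A point of \<open>E\<close> has its whole \<beta>-star in
        \<open>A\<close>.\<close>
      using point_star_round by metis
    obtain x where x: "x \<in> E" "x \<in> S"
      using eventually_happens'[OF _ b(3)] pointD(2) \<xi> topspace_completion
        Union_member[OF b(1)] b(2) by blast
    have "eventually (\<lambda>y. y \<in> A) (completion_map S U x)"
      unfolding completion_map_def eventually_nhdsin_uniform[OF x(2)] cover_star_singleton
      using b(1,4) x(1) by blast
    then have "completion_map S U x \<in> completion_lift S U A"
      using completion_map_point[OF x(2)] by (simp add: completion_lift_def)
    then show "\<exists>y. y \<in> completion_map S U ` S \<and> y \<in> V" using x A(2) by blast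
  qed
qed

end

section \<open>Compactness of the Samuel compactification\<close>

text \<open>Zorn's lemma is applied to the families \<open>Z G\<close>, since \<open>Z\<close> turns
  finer filters into larger sets. The union of a chain comes from the infimum filter: a chain is
  directed, so the infimum has no new members and stays proper. A maximal filter decides every
  \<open>P\<close>, because adjoining a \<open>P\<close> whose negation it does not contain yields a
  proper filter that is no finer.\<close>

lemma ultrafilter_below:
  assumes "F \<noteq> bot"
  obtains G where "G \<le> F" "G \<noteq> bot" "\<And>P. eventually P G \<or> eventually (\<lambda>x. \<not> P x) G"
proof -
  define Z where "Z G = {P. eventually P G}" for G :: "'a filter"
  define \<A> where "\<A> = Z ` {G. G \<le> F \<and> G \<noteq> bot}"
  have Z_mono: "Z G \<subseteq> Z H \<longleftrightarrow> H \<le> G" for G H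
    by (auto simp: Z_def le_filter_def)
  have "\<exists>M\<in>\<A>. \<forall>X\<in>\<A>. M \<subseteq> X \<longrightarrow> X = M"
  proof (rule subset_Zorn_nonempty)
    show "\<A> \<noteq> {}" using assms by (auto simp: \<A>_def)
    fix \<C> assume ne: "\<C> \<noteq> {}" and ch: "subset.chain \<A> \<C>"
    define B where "B = {G. G \<le> F \<and> G \<noteq> bot \<and> Z G \<in> \<C>}"
    have C: "\<C> = Z ` B"
      using ch unfolding subset.chain_def B_def \<A>_def by blast
    then have B: "B \<noteq> {}" using ne by blast
    have lin: "G \<le> H \<or> H \<le> G" if "G \<in> B" "H \<in> B" for G H
      using ch that C Z_mono unfolding subset_chain_def by (metis imageI)
    have base: "\<exists>K\<in>B. K \<le> inf G H" if "G \<in> B" "H \<in> B" for G H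
      using lin[OF that] that by (metis inf.absorb1 inf.absorb2 order_refl)
    have ev: "eventually P (Inf B) \<longleftrightarrow> (\<exists>G\<in>B. eventually P G)" for P
      by (rule eventually_Inf_base[OF B base])
    have "\<Union>\<C> = Z (Inf B)" unfolding C by (auto simp: Z_def ev)
    moreover have "Inf B \<le> F" using B by (auto simp: B_def intro: Inf_lower2)
    moreover have "Inf B \<noteq> bot"
      unfolding trivial_limit_def ev by (auto simp: B_def trivial_limit_def)
    ultimately show "\<Union>\<C> \<in> \<A>" by (auto simp: \<A>_def)
  qed
  then obtain M where M: "M \<in> \<A>" "\<forall>X\<in>\<A>. M \<subseteq> X \<longrightarrow> X = M" by blast
  then obtain G where G: "G \<le> F" "G \<noteq> bot" "M = Z G" by (auto simp: \<A>_def)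
  have max: "G \<le> H" if H: "H \<le> F" "H \<noteq> bot" "H \<le> G" for H
  proof -
    have "Z H \<in> \<A>" using H by (auto simp: \<A>_def)
    moreover have "M \<subseteq> Z H" using H(3) G(3) Z_mono by simp
    ultimately have "Z H = Z G" using M(2) G(3) by simp
    then show ?thesis using Z_mono[of H G] by simp
  qed
  have "eventually P G \<or> eventually (\<lambda>x. \<not> P x) G" for P
  proof (rule disjCI)
    assume "\<not> eventually (\<lambda>x. \<not> P x) G"
    then have "inf G (principal {x. P x}) \<noteq> bot"
      by (simp add: trivial_limit_def eventually_inf_principal)
    then have "G \<le> inf G (principal {x. P x})"
      using G by (intro max) (auto intro: le_infI1)
    then show "eventually P G" by (simp add: le_principal)
  qed
  then show ?thesis using that G by blast
qed

context covering_uniform_space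
begin

text \<open>
  An ultrafilter \<open>W\<close> of points induces the Cauchy filter of all sets whose lift belongs to \<open>W\<close>,
  and \<open>W\<close> converges to its envelope.
\<close>

lemma compact_completion:
  assumes tb: "\<And>\<alpha>. \<alpha> \<in> U \<Longrightarrow> \<exists>\<beta>\<in>U. finite \<beta> \<and> cover_refines \<beta> \<alpha>"
  shows "compact_space completion_topology"
  unfolding compact_space_alt topspace_completion
proof (intro allI impI, elim conjE, rule ccontr)
  let ?pts = "completion_points S U"
  fix \<V> assume op: "\<forall>V\<in>\<V>. openin completion_topology V" and cov: "?pts \<subseteq> \<Union>\<V>"
    and no: "\<not> (\<exists>\<F>. finite \<F> \<and> \<F> \<subseteq> \<V> \<and> ?pts \<subseteq> \<Union>\<F>)"
  \<comment> \<open>Inserting the empty set puts \<open>principal ?pts\<close> among the filters, so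
    that \<open>H\<close> lives on the points of the completion even when the cover is
    empty.\<close>
  define H where "H = (INF V\<in>insert {} \<V>. principal (?pts - V))"
  have "H \<noteq> bot"
    unfolding H_def
  proof (rule INF_filter_not_bot)
    fix X assume X: "X \<subseteq> insert {} \<V>" "finite X"
    then have "\<not> ?pts \<subseteq> \<Union>(X - {{}})" using no by blast
    then have "(\<Inter>V\<in>X. ?pts - V) \<noteq> {}" by blast
    then show "(INF V\<in>X. principal (?pts - V)) \<noteq> bot"
      by (simp add: INF_principal_finite[OF X(2)] principal_eq_bot_iff)
  qed
  then obtain W where W: "W \<le> H" "W \<noteq> bot"
    and ultra: "\<And>P. eventually P W \<or> eventually (\<lambda>x. \<not> P x) W"
    using ultrafilter_below by blast
  have avoid: "eventually (\<lambda>\<xi>. \<xi> \<in> ?pts - V) W" if "V \<in> insert {} \<V>" for V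
    using W(1) that unfolding H_def le_INF_iff le_principal by blast
  have pts: "eventually (\<lambda>\<xi>. \<xi> \<in> ?pts) W" using avoid[of "{}"] by simp
  define F where "F = Abs_filter (\<lambda>P. eventually (\<lambda>\<xi>. eventually P \<xi>) W)"
  have ev_F: "eventually P F \<longleftrightarrow> eventually (\<lambda>\<xi>. eventually P \<xi>) W" for P
    unfolding F_def
  proof (rule eventually_Abs_filter, rule is_filter.intro)
    fix P Q :: "'a \<Rightarrow> bool"
    assume "\<forall>x. P x \<longrightarrow> Q x" "eventually (\<lambda>\<xi>. eventually P \<xi>) W"
    then show "eventually (\<lambda>\<xi>. eventually Q \<xi>) W"
      by (elim eventually_mono) (auto elim: eventually_mono)
  next
    fix P Q :: "'a \<Rightarrow> bool"
    assume "eventually (\<lambda>\<xi>. eventually P \<xi>) W" "eventually (\<lambda>\<xi>. eventually Q \<xi>) W"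
    then show "eventually (\<lambda>\<xi>. eventually (\<lambda>x. P x \<and> Q x) \<xi>) W"
      by eventually_elim (rule eventually_conj)
  qed (rule eventuallyI, simp)
  have F: "cauchy_filter_wrt S U F"
    unfolding cauchy_filter_wrt_def
  proof (intro conjI ballI)
    have "\<not> eventually (\<lambda>\<xi>. \<xi> = bot) W"
    proof
      assume "eventually (\<lambda>\<xi>. \<xi> = bot) W"
      then have "eventually (\<lambda>\<xi>. False) W"
        using pts by eventually_elim (auto dest: pointD(2))
      then show False using W(2) by (simp add: trivial_limit_def)
    qed
    then show "F \<noteq> bot" by (simp add: trivial_limit_def ev_F)
    show "F \<le> principal S"
      unfolding le_principal ev_F using pts by eventually_elim (rule pointD(4))
    fix \<alpha> assume "\<alpha> \<in> U"
    then obtain \<beta> where b: "\<beta> \<in> U" "finite \<beta>" "cover_refines \<beta> \<alpha>" using tb by blast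
    \<comment> \<open>Total boundedness enters here: an ultrafilter that rejects the lift of each of
      finitely many sets rejects all of them simultaneously, although every point lies in one of
      these lifts.\<close>
    have "\<exists>E\<in>\<beta>. eventually (\<lambda>\<xi>. eventually (\<lambda>x. x \<in> E) \<xi>) W"
    proof (rule ccontr)
      assume "\<not> ?thesis"
      then have "\<forall>E\<in>\<beta>. eventually (\<lambda>\<xi>. \<not> eventually (\<lambda>x. x \<in> E) \<xi>) W" using ultra by blast
      then have "eventually (\<lambda>\<xi>. \<forall>E\<in>\<beta>. \<not> eventually (\<lambda>x. x \<in> E) \<xi>) W"
        by (rule eventually_ball_finite[OF b(2)])
      with pts have "eventually (\<lambda>\<xi>. False) W"
        by eventually_elim (use point_member b(1) in blast)
      then show False using W(2) by (simp add: trivial_limit_def)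
    qed
    then obtain E where E: "E \<in> \<beta>" "eventually (\<lambda>x. x \<in> E) F" by (auto simp: ev_F)
    then obtain A where A: "A \<in> \<alpha>" "E \<subseteq> A" using b(3) unfolding cover_refines_def by blast
    show "\<exists>A\<in>\<alpha>. eventually (\<lambda>x. x \<in> A) F"
      using eventually_superset[OF E(2) A(2)] A(1) by blast
  qed
  \<comment> \<open>Some \<open>V\<close> of the cover contains the envelope, hence a basic lift
    around it that belongs to the ultrafilter. But the ultrafilter was chosen to contain the
    complement of every such \<open>V\<close>.\<close>
  obtain V where V: "V \<in> \<V>" "envelope F \<in> V" using cov envelope_point[OF F] by blast
  obtain A where A: "envelope F \<in> completion_lift S U A" "completion_lift S U A \<subseteq> V"
    using openin_completionD[of V "envelope F"] op V by blast
  then have "eventually (\<lambda>x. x \<in> A) (envelope F)" by (simp add: completion_lift_def)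
  then have "eventually (\<lambda>x. x \<in> A) F" by (rule filter_leD[OF cauchy_le_envelope[OF F]])
  then have "eventually (\<lambda>\<xi>. eventually (\<lambda>x. x \<in> A) \<xi>) W" by (simp add: ev_F)
  moreover have "eventually (\<lambda>\<xi>. \<xi> \<in> ?pts - V) W" using avoid V(1) by blast
  ultimately have "eventually (\<lambda>\<xi>. False) W"
    by eventually_elim (use A(2) in \<open>auto simp: completion_lift_def\<close>)
  then show False using W(2) by (simp add: trivial_limit_def)
qed

section \<open>The totally bounded part of a uniformity\<close>

lemma totally_bounded_part_subset: "totally_bounded_part S U \<subseteq> U"
  using refined_by_member by (auto simp: totally_bounded_part_def)

lemma finite_in_totally_bounded_part:
  assumes "\<beta> \<in> U" "finite \<beta>"
  shows "\<beta> \<in> totally_bounded_part S U"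
proof -
  have "cover_refines \<beta> \<beta>" by (auto simp: cover_refines_def)
  then show ?thesis
    using assms Union_member by (auto simp: totally_bounded_part_def covering_of_def)
qed

text \<open>Two-element covers suffice to recover every neighbourhood. If the \<gamma>-star of
  \<open>x\<close> lies in \<open>W\<close>, an element of \<gamma> is contained in \<open>W\<close>
  or in \<open>S - {x}\<close>, according to whether it contains \<open>x\<close>; and the star of
  \<open>x\<close> in the cover by these two sets is \<open>W\<close>.\<close>

lemma uniform_topology_totally_bounded_part:
  "uniform_topology S (totally_bounded_part S U) = uniform_topology S U"
  unfolding topology_eq
proof (intro allI iffI)
  note op = openin_uniform_topology[OF uniformity]
    openin_uniform_topology[OF covering_uniformity_totally_bounded_part[OF uniformity]]
  fix W
  show "openin (uniform_topology S U) W"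
    if "openin (uniform_topology S (totally_bounded_part S U)) W"
    using that totally_bounded_part_subset unfolding op by blast
  assume W: "openin (uniform_topology S U) W"
  show "openin (uniform_topology S (totally_bounded_part S U)) W"
    unfolding op(2)
  proof (intro conjI ballI)
    show "W \<subseteq> S" using W op(1) by blast
    fix x assume x: "x \<in> W"
    then obtain \<gamma> where g: "\<gamma> \<in> U" "cover_star {x} \<gamma> \<subseteq> W" using W op(1) by blast
    have "covering_of S {W, S - {x}}"
      using x \<open>W \<subseteq> S\<close> by (auto simp: covering_of_def)
    moreover have "cover_refines \<gamma> {W, S - {x}}"
      unfolding cover_refines_def
    proof
      fix E assume E: "E \<in> \<gamma>"
      show "\<exists>D\<in>{W, S - {x}}. E \<subseteq> D"
      proof (cases "x \<in> E")
        case True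
        then have "E \<subseteq> W" using E g(2) by (auto simp: cover_star_singleton)
        then show ?thesis by simp
      next
        case False
        then have "E \<subseteq> S - {x}" using E Union_member[OF g(1)] by blast
        then show ?thesis by simp
      qed
    qed
    ultimately have "{W, S - {x}} \<in> totally_bounded_part S U"
      using refined_by_member[OF g(1)] finite_in_totally_bounded_part by blast
    moreover have "cover_star {x} {W, S - {x}} \<subseteq> W"
      by (auto simp: cover_star_singleton)
    ultimately show "\<exists>\<gamma>\<in>totally_bounded_part S U. cover_star {x} \<gamma> \<subseteq> W" by blast
  qed
qed

lemma totally_bounded_part_uniform_space:
  "covering_uniform_space S (totally_bounded_part S U)"
proof
  show "covering_uniformity S (totally_bounded_part S U)"
    by (rule covering_uniformity_totally_bounded_part[OF uniformity])
  obtain \<gamma> where g: "\<gamma> \<in> U" using nonempty by blast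
  have "cover_refines \<gamma> {S}"
    using Union_member[OF g] unfolding cover_refines_def by blast
  then have "{S} \<in> U"
    using refined_by_member[OF g] by (simp add: covering_of_def)
  then show "totally_bounded_part S U \<noteq> {}"
    using finite_in_totally_bounded_part by blast
qed

lemma compact_samuel_compactification: "compact_space (samuel_compactification S U)"
proof -
  interpret tb: covering_uniform_space S "totally_bounded_part S U"
    by (rule totally_bounded_part_uniform_space)
  show ?thesis
    unfolding samuel_compactification_def
  proof (rule tb.compact_completion)
    fix \<alpha> assume "\<alpha> \<in> totally_bounded_part S U"
    then obtain \<beta> where "\<beta> \<in> U" "finite \<beta>" "cover_refines \<beta> \<alpha>"
      unfolding totally_bounded_part_def by blast
    then show "\<exists>\<beta>\<in>totally_bounded_part S U. finite \<beta> \<and> cover_refines \<beta> \<alpha>"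
      using finite_in_totally_bounded_part by blast
  qed
qed

end

section \<open>Extension of uniformly continuous maps\<close>

lemma limitin_closed:
  assumes "limitin K e l F" "F \<noteq> bot" "closedin K C" "eventually (\<lambda>x. e x \<in> C) F"
  shows "l \<in> C"
proof (rule ccontr)
  assume "l \<notin> C"
  then have "eventually (\<lambda>x. e x \<in> topspace K - C) F"
    using assms(1,3) unfolding limitin_def by blast
  with assms(4) have "eventually (\<lambda>x. False) F" by eventually_elim simp
  then show False using assms(2) by (simp add: trivial_limit_def)
qed

lemma limitin_nhdsin:
  assumes "continuous_map X K e" "x \<in> topspace X"
  shows "limitin K e (e x) (nhdsin X x)"
  unfolding limitin_def
proof (intro conjI allI impI, goal_cases)
  case 1
  show ?case using assms unfolding continuous_map_def by blast
next
  case (2 W)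
  then have "openin X {y \<in> topspace X. e y \<in> W}" using assms(1) unfolding continuous_map_def by blast
  then show ?case using 2 assms(2) unfolding eventually_nhdsin by blast
qed

text \<open>Minimality can be lost under such a map: a constant map produces a principal filter,
  which is strictly finer than the neighbourhood filter unless the value is isolated.\<close>

lemma cauchy_filtermap:
  assumes F: "cauchy_filter_wrt S U F" and f: "f \<in> S \<rightarrow> S'"
    and unif: "\<And>\<alpha>. \<alpha> \<in> U' \<Longrightarrow> (\<lambda>A. {x\<in>S. f x \<in> A}) ` \<alpha> \<in> U"
  shows "cauchy_filter_wrt S' U' (filtermap f F)"
  unfolding cauchy_filter_wrt_def
proof (intro conjI ballI)
  show "filtermap f F \<noteq> bot"
    using F by (simp add: cauchy_filter_wrt_def filtermap_bot_iff)
  have "eventually (\<lambda>x. x \<in> S) F"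
    using F by (simp add: cauchy_filter_wrt_def le_principal)
  then show "filtermap f F \<le> principal S'"
    unfolding le_principal eventually_filtermap
    by (rule eventually_mono) (use f in blast)
  fix \<alpha> assume "\<alpha> \<in> U'"
  have "\<forall>\<gamma>\<in>U. \<exists>E\<in>\<gamma>. eventually (\<lambda>x. x \<in> E) F"
    using F unfolding cauchy_filter_wrt_def by (elim conjE)
  from bspec[OF this unif[OF \<open>\<alpha> \<in> U'\<close>]] obtain A where A: "A \<in> \<alpha>" "eventually (\<lambda>x. x \<in> {x\<in>S. f x \<in> A}) F" by blast
  have "eventually (\<lambda>x. x \<in> A) (filtermap f F)"
    unfolding eventually_filtermap using A(2) by (rule eventually_mono) simp
  then show "\<exists>A\<in>\<alpha>. eventually (\<lambda>x. x \<in> A) (filtermap f F)" using A(1) by blast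
qed

lemma filtermap_cong_on:
  assumes "eventually (\<lambda>x. x \<in> S) F" "\<And>x. x \<in> S \<Longrightarrow> f x = g x"
  shows "filtermap f F = filtermap g F"
proof (rule filter_eqI)
  fix P
  show "eventually P (filtermap f F) = eventually P (filtermap g F)"
    unfolding eventually_filtermap
    by (rule eventually_subst, rule eventually_mono[OF assms(1)]) (simp add: assms(2))
qed

lemma regular_space_closed_neighbourhood:
  assumes "regular_space K" "openin K W" "x \<in> W"
  obtains V C where "openin K V" "closedin K C" "x \<in> V" "V \<subseteq> C" "C \<subseteq> W"
proof -
  have "closedin K (topspace K - W)" "x \<in> topspace K - (topspace K - W)"
    using assms(2,3) openin_subset[OF assms(2)] by auto
  then obtain V where V: "openin K V" "x \<in> V" "disjnt (topspace K - W) (K closure_of V)"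
    using assms(1)[unfolded regular_space, rule_format, of "topspace K - W" x] by blast
  show ?thesis
  proof
    show "openin K V" "x \<in> V" "closedin K (K closure_of V)" using V by simp_all
    show "V \<subseteq> K closure_of V" using V(1) by (simp add: closure_of_subset openin_subset)
    show "K closure_of V \<subseteq> W"
      using V(3) closure_of_subset_topspace[of K V] unfolding disjnt_def by blast
  qed
qed

context covering_uniform_space
begin

text \<open>Without a limit, every point of \<open>K\<close> has an open neighbourhood that
  \<open>e\<close> does not eventually enter. Finitely many of these cover \<open>K\<close>, and
  their preimages form a uniform cover, one element of which must belong to the Cauchy
  filter.\<close>

lemma limitin_point:
  assumes K: "compact_space K" and e: "e \<in> S \<rightarrow> topspace K"
    and unif: "\<forall>\<W>. finite \<W> \<and> (\<forall>W\<in>\<W>. openin K W) \<and> topspace K \<subseteq> \<Union>\<W> \<longrightarrow>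
      (\<lambda>W. {x\<in>S. e x \<in> W}) ` \<W> \<in> U"
    and \<xi>: "\<xi> \<in> completion_points S U"
  shows "\<exists>l. limitin K e l \<xi>"
proof (rule ccontr)
  assume no: "\<not> ?thesis"
  define \<O> where "\<O> = {W. openin K W \<and> \<not> eventually (\<lambda>x. e x \<in> W) \<xi>}"
  have "\<exists>W\<in>\<O>. b \<in> W" if "b \<in> topspace K" for b
    using no that unfolding limitin_def \<O>_def by blast
  then have "topspace K \<subseteq> \<Union>\<O>" by blast
  moreover have "\<forall>W\<in>\<O>. openin K W" by (simp add: \<O>_def)
  ultimately obtain \<W> where W: "finite \<W>" "\<W> \<subseteq> \<O>" "topspace K \<subseteq> \<Union>\<W>"
    using K[unfolded compact_space_alt, rule_format, of \<O>] by blast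
  then have "(\<lambda>W. {x\<in>S. e x \<in> W}) ` \<W> \<in> U" by (intro unif[rule_format]) (auto simp: \<O>_def)
  then obtain E where "E \<in> (\<lambda>W. {x\<in>S. e x \<in> W}) ` \<W>" "eventually (\<lambda>x. x \<in> E) \<xi>"
    using point_member[OF \<xi>] by blast
  then obtain V where V: "V \<in> \<W>" "eventually (\<lambda>x. x \<in> {x\<in>S. e x \<in> V}) \<xi>" by blast
  have "eventually (\<lambda>x. e x \<in> V) \<xi>" using V(2) by (rule eventually_mono) simp
  then show False using V(1) W(2) unfolding \<O>_def by blast
qed

text \<open>The limits can be chosen pointwise and are still continuous: regularity gives open
  \<open>V\<close> and closed \<open>C\<close> with \<open>V \<subseteq> C \<subseteq> W\<close>,
  and at every point in the lift of the preimage of \<open>V\<close> the limit must lie in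
  \<open>C\<close>.\<close>

lemma extension_to_compact:
  assumes K: "compact_space K" "Hausdorff_space K" and e: "e \<in> S \<rightarrow> topspace K"
    and unif: "\<forall>\<W>. finite \<W> \<and> (\<forall>W\<in>\<W>. openin K W) \<and> topspace K \<subseteq> \<Union>\<W> \<longrightarrow>
      (\<lambda>W. {x\<in>S. e x \<in> W}) ` \<W> \<in> U"
  obtains f where "continuous_map completion_topology K f"
    "\<forall>\<xi>\<in>completion_points S U. limitin K e (f \<xi>) \<xi>"
proof -
  define f where "f \<xi> = (SOME l. limitin K e l \<xi>)" for \<xi>
  have lim: "limitin K e (f \<xi>) \<xi>" if "\<xi> \<in> completion_points S U" for \<xi>
    unfolding f_def by (rule someI_ex, rule limitin_point[OF K(1) e unif that])
  have reg: "regular_space K" using K compact_Hausdorff_imp_regular_space by blast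
  have "continuous_map completion_topology K f"
    unfolding continuous_map_def topspace_completion
  proof (intro conjI allI impI)
    show "f \<in> completion_points S U \<rightarrow> topspace K"
      using lim unfolding limitin_def by blast
    fix W assume W: "openin K W"
    show "openin completion_topology {\<xi> \<in> completion_points S U. f \<xi> \<in> W}"
    proof (subst openin_subopen, intro ballI)
      fix \<xi> assume "\<xi> \<in> {\<xi> \<in> completion_points S U. f \<xi> \<in> W}"
      then have \<xi>: "\<xi> \<in> completion_points S U" "f \<xi> \<in> W" by simp_all
      obtain V C where V: "openin K V" "closedin K C" "f \<xi> \<in> V" "V \<subseteq> C" "C \<subseteq> W"
        using regular_space_closed_neighbourhood[OF reg W \<xi>(2)] .
      let ?A = "{x\<in>S. e x \<in> V}"
      have "eventually (\<lambda>x. e x \<in> V) \<xi>" using lim[OF \<xi>(1)] V unfolding limitin_def by blast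
      then have "eventually (\<lambda>x. x \<in> ?A) \<xi>"
        using pointD(4)[OF \<xi>(1)] by eventually_elim simp
      then have "\<xi> \<in> completion_lift S U ?A" using \<xi>(1) by (simp add: completion_lift_def)
      moreover have "completion_lift S U ?A \<subseteq> {\<xi> \<in> completion_points S U. f \<xi> \<in> W}"
      proof
        fix \<zeta> assume "\<zeta> \<in> completion_lift S U ?A"
        then have \<zeta>: "\<zeta> \<in> completion_points S U" "eventually (\<lambda>x. x \<in> ?A) \<zeta>"
          by (simp_all add: completion_lift_def)
        have "eventually (\<lambda>x. e x \<in> C) \<zeta>"
          using \<zeta>(2) by (rule eventually_mono) (use V(4) in blast)
        then have "f \<zeta> \<in> C"
          by (rule limitin_closed[OF lim[OF \<zeta>(1)] pointD(2)[OF \<zeta>(1)] V(2)])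
        then show "\<zeta> \<in> {\<xi> \<in> completion_points S U. f \<xi> \<in> W}" using V(5) \<zeta>(1) by blast
      qed
      ultimately show "\<exists>T. openin completion_topology T \<and> \<xi> \<in> T \<and>
          T \<subseteq> {\<xi> \<in> completion_points S U. f \<xi> \<in> W}"
        using openin_completion_lift by blast
    qed
  qed
  then show ?thesis using that lim by blast
qed

end

text \<open>The inverse restores minimality. Pushing the envelope of the image back along
  \<open>g\<close> gives a Cauchy filter coarser than \<xi>, hence \<xi> itself; pushing forward
  again shows that the image equals its envelope.\<close>

lemma (in covering_uniform_space) filtermap_point:
  assumes f: "f \<in> S \<rightarrow> S" "\<And>\<alpha>. \<alpha> \<in> U \<Longrightarrow> (\<lambda>A. {x\<in>S. f x \<in> A}) ` \<alpha> \<in> U"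
    and g: "g \<in> S \<rightarrow> S" "\<And>\<alpha>. \<alpha> \<in> U \<Longrightarrow> (\<lambda>A. {x\<in>S. g x \<in> A}) ` \<alpha> \<in> U"
    and inv: "\<And>x. x \<in> S \<Longrightarrow> f (g x) = x" "\<And>x. x \<in> S \<Longrightarrow> g (f x) = x"
    and \<xi>: "\<xi> \<in> completion_points S U"
  shows "filtermap f \<xi> \<in> completion_points S U"
proof -
  have F: "cauchy_filter_wrt S U (filtermap f \<xi>)"
    by (rule cauchy_filtermap[OF pointD(1)[OF \<xi>] f])
  let ?\<zeta> = "envelope (filtermap f \<xi>)"
  have \<zeta>: "?\<zeta> \<in> completion_points S U" "cauchy_filter_wrt S U ?\<zeta>"
    using envelope_point[OF F] envelope_cauchy[OF F] by auto
  have "filtermap g (filtermap f \<xi>) = filtermap (\<lambda>x. x) \<xi>"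
    unfolding filtermap_filtermap by (rule filtermap_cong_on[OF pointD(4)[OF \<xi>] inv(2)])
  then have "\<xi> \<le> filtermap g ?\<zeta>"
    using filtermap_mono[OF cauchy_le_envelope[OF F], of g] by (simp add: filtermap_ident)
  then have "filtermap g ?\<zeta> = \<xi>"
    using \<xi> cauchy_filtermap[OF \<zeta>(2) g] unfolding completion_points_def by blast
  then have "filtermap f \<xi> = filtermap f (filtermap g ?\<zeta>)" by simp
  also have "\<dots> = filtermap (\<lambda>x. x) ?\<zeta>"
    unfolding filtermap_filtermap by (rule filtermap_cong_on[OF pointD(4)[OF \<zeta>(1)] inv(1)])
  finally show ?thesis using \<zeta>(1) by (simp add: filtermap_ident)
qed

lemma covering_of_vimage:
  assumes "covering_of S' \<alpha>" "f \<in> S \<rightarrow> S'"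
  shows "covering_of S ((\<lambda>A. {x\<in>S. f x \<in> A}) ` \<alpha>)"
  using assms unfolding covering_of_def by blast

lemma totally_bounded_part_vimage:
  assumes "\<And>\<alpha>. \<alpha> \<in> U' \<Longrightarrow> (\<lambda>A. {x\<in>S. f x \<in> A}) ` \<alpha> \<in> U" and f: "f \<in> S \<rightarrow> S'"
    and \<alpha>: "\<alpha> \<in> totally_bounded_part S' U'"
  shows "(\<lambda>A. {x\<in>S. f x \<in> A}) ` \<alpha> \<in> totally_bounded_part S U"
proof -
  obtain \<beta> where b: "\<beta> \<in> U'" "finite \<beta>" "cover_refines \<beta> \<alpha>" and cov: "covering_of S' \<alpha>"
    using \<alpha> unfolding totally_bounded_part_def by blast
  let ?f = "\<lambda>A. {x\<in>S. f x \<in> A}"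
  have "covering_of S (?f ` \<alpha>)"
    using cov f by (rule covering_of_vimage)
  moreover have "cover_refines (?f ` \<beta>) (?f ` \<alpha>)"
    unfolding cover_refines_def
  proof
    fix E assume "E \<in> ?f ` \<beta>"
    then obtain B where B: "B \<in> \<beta>" "E = ?f B" by blast
    then obtain A where "A \<in> \<alpha>" "B \<subseteq> A" using b(3) unfolding cover_refines_def by blast
    then show "\<exists>D\<in>?f ` \<alpha>. E \<subseteq> D" using B(2) by (intro bexI[of _ "?f A"]) auto
  qed
  ultimately show ?thesis
    using assms(1)[OF b(1)] b(2) unfolding totally_bounded_part_def by blast
qed

section \<open>The action on the Samuel compactification\<close>

lemma topological_group_conjugation_continuous:
  assumes "topological_group G T" "g \<in> carrier G"
  shows "continuous_map T T (\<lambda>h. g \<otimes>\<^bsub>G\<^esub> h \<otimes>\<^bsub>G\<^esub> inv\<^bsub>G\<^esub> g)"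
proof -
  interpret group G using assms(1) by (simp add: topological_group_def)
  have top: "topspace T = carrier G" using assms(1) by (simp add: topological_group_def)
  have mult: "continuous_map (prod_topology T T) T (\<lambda>(g, h). g \<otimes>\<^bsub>G\<^esub> h)"
    using assms(1) by (simp add: topological_group_def)
  have "continuous_map T T ((\<lambda>(g, h). g \<otimes>\<^bsub>G\<^esub> h) \<circ> (\<lambda>h. (g, h)))"
    by (rule continuous_map_compose[OF _ mult])
      (simp add: continuous_map_pairwise o_def top assms(2))
  then have left: "continuous_map T T (\<lambda>h. g \<otimes>\<^bsub>G\<^esub> h)" by (simp add: o_def)
  have "continuous_map T T ((\<lambda>(g, h). g \<otimes>\<^bsub>G\<^esub> h) \<circ> (\<lambda>h. (g \<otimes>\<^bsub>G\<^esub> h, inv\<^bsub>G\<^esub> g)))"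
    by (rule continuous_map_compose[OF _ mult])
      (use left in \<open>simp add: continuous_map_pairwise o_def top assms(2)\<close>)
  then show ?thesis by (simp add: o_def)
qed

lemma topological_group_right_translation_continuous:
  assumes "topological_group G T" "g \<in> carrier G"
  shows "continuous_map T T (\<lambda>h. h \<otimes>\<^bsub>G\<^esub> g)"
proof -
  have top: "topspace T = carrier G" using assms(1) by (simp add: topological_group_def)
  have mult: "continuous_map (prod_topology T T) T (\<lambda>(g, h). g \<otimes>\<^bsub>G\<^esub> h)"
    using assms(1) by (simp add: topological_group_def)
  have "continuous_map T T ((\<lambda>(g, h). g \<otimes>\<^bsub>G\<^esub> h) \<circ> (\<lambda>h. (h, g)))"
    by (rule continuous_map_compose[OF _ mult])
      (simp add: continuous_map_pairwise o_def top assms(2))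
  then show ?thesis by (simp add: o_def)
qed

lemma G_space_translation_continuous:
  assumes "topological_group G T" "G_space G T X \<phi>" "g \<in> carrier G"
  shows "continuous_map X X (\<phi> g)"
proof -
  have top: "topspace T = carrier G" using assms(1) by (simp add: topological_group_def)
  have act: "continuous_map (prod_topology T X) X (\<lambda>(g, x). \<phi> g x)"
    using assms(2) by (simp add: G_space_def)
  have "continuous_map X X ((\<lambda>(g, x). \<phi> g x) \<circ> (\<lambda>x. (g, x)))"
    by (rule continuous_map_compose[OF _ act])
      (simp add: continuous_map_pairwise o_def top assms(3))
  then show ?thesis by (simp add: o_def)
qed

locale orbit_closure_uniform_space =
  fixes G :: "('g, 'm) monoid_scheme" and T :: "'g topology"
    and X :: "'x topology" and \<phi> :: "'g \<Rightarrow> 'x \<Rightarrow> 'x"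
  assumes top_group: "topological_group G T"
    and G_space: "G_space G T X \<phi>"
    and orbit_uniformity: "covering_uniformity (topspace X) (orbit_closure_uniformity G T X \<phi>)"
    and compatible: "compatible_uniformity X (orbit_closure_uniformity G T X \<phi>)"
begin

abbreviation "\<U> \<equiv> orbit_closure_uniformity G T X \<phi>"
abbreviation "\<P> \<equiv> totally_bounded_part (topspace X) \<U>"

sublocale group G
  using top_group by (simp add: topological_group_def)

sublocale group_action G "topspace X" \<phi>
  using G_space by (simp add: G_space_def)

lemma topspace_group: "topspace T = carrier G"
  using top_group by (simp add: topological_group_def)

lemma orbit_closure_uniformityI:
  assumes "covering_of (topspace X) \<alpha>" "openin T N" "\<one>\<^bsub>G\<^esub> \<in> N"
    and "\<And>x. x \<in> topspace X \<Longrightarrow> \<exists>A\<in>\<alpha>. X closure_of ((\<lambda>g. \<phi> g x) ` N) \<subseteq> A"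
  shows "\<alpha> \<in> \<U>"
proof -
  have "cover_refines (orbit_closure_cover X \<phi> N) \<alpha>"
    using assms(4) unfolding cover_refines_def orbit_closure_cover_def by blast
  then show ?thesis using assms(1-3) unfolding orbit_closure_uniformity_def by blast
qed

lemma orbit_closure_uniformityE:
  assumes "\<alpha> \<in> \<U>"
  obtains N where "openin T N" "\<one>\<^bsub>G\<^esub> \<in> N"
    "\<And>x. x \<in> topspace X \<Longrightarrow> \<exists>A\<in>\<alpha>. X closure_of ((\<lambda>g. \<phi> g x) ` N) \<subseteq> A"
proof -
  obtain N where N: "openin T N" "\<one>\<^bsub>G\<^esub> \<in> N" "cover_refines (orbit_closure_cover X \<phi> N) \<alpha>"
    using assms unfolding orbit_closure_uniformity_def by blast
  show ?thesis
  proof (rule that[OF N(1,2)])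
    fix x assume "x \<in> topspace X"
    then show "\<exists>A\<in>\<alpha>. X closure_of ((\<lambda>g. \<phi> g x) ` N) \<subseteq> A"
      using N(3) unfolding cover_refines_def orbit_closure_cover_def by blast
  qed
qed

lemma orbit_subset:
  assumes "openin T N" "x \<in> topspace X"
  shows "(\<lambda>g. \<phi> g x) ` N \<subseteq> topspace X"
  using assms openin_subset[OF assms(1)] element_image topspace_group by blast

sublocale covering_uniform_space "topspace X" "\<U>"
proof
  show "covering_uniformity (topspace X) \<U>" by (rule orbit_uniformity)
  have "{topspace X} \<in> \<U>"
  proof (rule orbit_closure_uniformityI)
    show "covering_of (topspace X) {topspace X}" by (simp add: covering_of_def)
    show "openin T (carrier G)" using openin_topspace[of T] by (simp add: topspace_group)
    show "\<one>\<^bsub>G\<^esub> \<in> carrier G" by simp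
  qed (simp add: closure_of_subset_topspace)
  then show "\<U> \<noteq> {}" by blast
qed

sublocale tb: covering_uniform_space "topspace X" "\<P>"
  by (rule totally_bounded_part_uniform_space)

abbreviation "points \<equiv> completion_points (topspace X) \<P>"

lemma uniform_topology_eq: "uniform_topology (topspace X) \<P> = X"
  using compatible uniform_topology_totally_bounded_part
  by (simp add: compatible_uniformity_def)

section \<open>Translations and the induced group action\<close>

lemma action_closed: "g \<in> carrier G \<Longrightarrow> \<phi> g \<in> topspace X \<rightarrow> topspace X"
  using element_image by blast

text \<open>The translation by \<open>g\<close> carries the cover given by \<open>N\<close> to the one given by \<open>g N g\<^sup>-\<^sup>1\<close>.\<close>

lemma uniform_translation:
  assumes g: "g \<in> carrier G" and \<alpha>: "\<alpha> \<in> \<U>"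
  shows "(\<lambda>A. {x\<in>topspace X. \<phi> g x \<in> A}) ` \<alpha> \<in> \<U>"
proof -
  obtain N where N: "openin T N" "\<one>\<^bsub>G\<^esub> \<in> N"
    "\<And>x. x \<in> topspace X \<Longrightarrow> \<exists>A\<in>\<alpha>. X closure_of ((\<lambda>g. \<phi> g x) ` N) \<subseteq> A"
    by (rule orbit_closure_uniformityE[OF \<alpha>]) (rule that; blast)
  \<comment> \<open>\<open>M\<close> is the conjugate g^-1 N g, so that g h g^-1 runs through
    \<open>N\<close> for \<open>h\<close> in \<open>M\<close>.\<close>
  define M where "M = {h \<in> topspace T. g \<otimes>\<^bsub>G\<^esub> h \<otimes>\<^bsub>G\<^esub> inv\<^bsub>G\<^esub> g \<in> N}"
  show ?thesis
  proof (rule orbit_closure_uniformityI)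
    show "covering_of (topspace X) ((\<lambda>A. {x\<in>topspace X. \<phi> g x \<in> A}) ` \<alpha>)"
      using covering_uniformity_covering_of[OF orbit_uniformity \<alpha>] action_closed[OF g]
      by (rule covering_of_vimage)
    show "openin T M"
      unfolding M_def
      by (rule openin_continuous_map_preimage[OF
            topological_group_conjugation_continuous[OF top_group g] N(1)])
    show "\<one>\<^bsub>G\<^esub> \<in> M" using N(2) g by (simp add: M_def topspace_group)
    fix x assume x: "x \<in> topspace X"
    have gx: "\<phi> g x \<in> topspace X" using element_image g x by blast
    obtain A where A: "A \<in> \<alpha>" "X closure_of ((\<lambda>h. \<phi> h (\<phi> g x)) ` N) \<subseteq> A"
      using N(3)[OF gx] by blast
    \<comment> \<open>Since g h x = (g h g^-1)(g x), translation by \<open>g\<close> sends the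
      \<open>M\<close>-orbit piece of \<open>x\<close> into the \<open>N\<close>-orbit piece of
      \<open>g x\<close>. Continuity of the translation then carries this inclusion to
      closures.\<close>
    have "\<phi> g ` ((\<lambda>h. \<phi> h x) ` M) \<subseteq> (\<lambda>h. \<phi> h (\<phi> g x)) ` N"
    proof (clarify, rule image_eqI)
      fix h assume "h \<in> M"
      then have h: "h \<in> carrier G" "g \<otimes>\<^bsub>G\<^esub> h \<otimes>\<^bsub>G\<^esub> inv\<^bsub>G\<^esub> g \<in> N"
        by (simp_all add: M_def topspace_group)
      show "g \<otimes>\<^bsub>G\<^esub> h \<otimes>\<^bsub>G\<^esub> inv\<^bsub>G\<^esub> g \<in> N" by (rule h(2))
      have "\<phi> (g \<otimes>\<^bsub>G\<^esub> h \<otimes>\<^bsub>G\<^esub> inv\<^bsub>G\<^esub> g) (\<phi> g x) =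
          \<phi> (g \<otimes>\<^bsub>G\<^esub> h) (\<phi> (inv\<^bsub>G\<^esub> g) (\<phi> g x))"
        using composition_rule[OF gx, of "g \<otimes>\<^bsub>G\<^esub> h" "inv\<^bsub>G\<^esub> g"] g h(1) by simp
      also have "\<dots> = \<phi> (g \<otimes>\<^bsub>G\<^esub> h) x" using orbit_sym_aux[OF g x refl] by simp
      also have "\<dots> = \<phi> g (\<phi> h x)" by (rule composition_rule[OF x g h(1)])
      finally show "\<phi> g (\<phi> h x) = \<phi> (g \<otimes>\<^bsub>G\<^esub> h \<otimes>\<^bsub>G\<^esub> inv\<^bsub>G\<^esub> g) (\<phi> g x)" by simp
    qed
    then have "X closure_of (\<phi> g ` ((\<lambda>h. \<phi> h x) ` M)) \<subseteq> A"
      using A(2) closure_of_mono by blast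
    then have "\<phi> g ` (X closure_of ((\<lambda>h. \<phi> h x) ` M)) \<subseteq> A"
      using continuous_map_image_closure_subset[OF
          G_space_translation_continuous[OF top_group G_space g]] by blast
    then have "X closure_of ((\<lambda>h. \<phi> h x) ` M) \<subseteq> {x\<in>topspace X. \<phi> g x \<in> A}"
      using closure_of_subset_topspace[of X] by blast
    then show "\<exists>A\<in>(\<lambda>A. {x\<in>topspace X. \<phi> g x \<in> A}) ` \<alpha>.
        X closure_of ((\<lambda>h. \<phi> h x) ` M) \<subseteq> A"
      using A(1) by blast
  qed
qed

lemma totally_bounded_translation:
  assumes "g \<in> carrier G" "\<alpha> \<in> \<P>"
  shows "(\<lambda>A. {x\<in>topspace X. \<phi> g x \<in> A}) ` \<alpha> \<in> \<P>"
  using uniform_translation[OF assms(1)] action_closed[OF assms(1)] assms(2)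
  by (rule totally_bounded_part_vimage)

text \<open>The restriction to \<open>points\<close> is forced by \<open>group_action\<close>, whose
  values are extensional bijections in \<open>Bij\<close>.\<close>

definition samuel_action :: "'g \<Rightarrow> 'x filter \<Rightarrow> 'x filter" where
  "samuel_action g = (\<lambda>\<xi>\<in>points. filtermap (\<phi> g) \<xi>)"

lemma translation_point:
  assumes g: "g \<in> carrier G" and \<xi>: "\<xi> \<in> points"
  shows "filtermap (\<phi> g) \<xi> \<in> points"
proof (rule tb.filtermap_point[OF _ _ _ _ _ _ \<xi>])
  have g': "inv\<^bsub>G\<^esub> g \<in> carrier G" using g by simp
  show "\<phi> g \<in> topspace X \<rightarrow> topspace X" "\<phi> (inv\<^bsub>G\<^esub> g) \<in> topspace X \<rightarrow> topspace X"
    using action_closed g g' by blast+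
  show "(\<lambda>A. {x\<in>topspace X. \<phi> g x \<in> A}) ` \<alpha> \<in> \<P>" if "\<alpha> \<in> \<P>" for \<alpha>
    using totally_bounded_translation[OF g that] .
  show "(\<lambda>A. {x\<in>topspace X. \<phi> (inv\<^bsub>G\<^esub> g) x \<in> A}) ` \<alpha> \<in> \<P>" if "\<alpha> \<in> \<P>" for \<alpha>
    using totally_bounded_translation[OF g' that] .
  fix x assume x: "x \<in> topspace X"
  show "\<phi> (inv\<^bsub>G\<^esub> g) (\<phi> g x) = x" by (rule orbit_sym_aux[OF g x refl])
  show "\<phi> g (\<phi> (inv\<^bsub>G\<^esub> g) x) = x" using orbit_sym_aux[OF g' x refl] g by simp
qed

lemma translation_mult:
  assumes "g \<in> carrier G" "h \<in> carrier G" "\<xi> \<in> points"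
  shows "filtermap (\<phi> (g \<otimes>\<^bsub>G\<^esub> h)) \<xi> = filtermap (\<phi> g) (filtermap (\<phi> h) \<xi>)"
  unfolding filtermap_filtermap
  by (rule filtermap_cong_on[OF tb.pointD(4)[OF assms(3)]]) (rule composition_rule[OF _ assms(1,2)])

lemma translation_one:
  assumes "\<xi> \<in> points"
  shows "filtermap (\<phi> \<one>\<^bsub>G\<^esub>) \<xi> = \<xi>"
proof -
  have "filtermap (\<phi> \<one>\<^bsub>G\<^esub>) \<xi> = filtermap (\<lambda>x. x) \<xi>"
    by (rule filtermap_cong_on[OF tb.pointD(4)[OF assms]])
      (metis id_eq_one restrict_apply')
  then show ?thesis by (simp add: filtermap_ident)
qed

lemma samuel_group_action: "group_action G points samuel_action"
proof -
  have bij: "samuel_action g \<in> Bij points" if g: "g \<in> carrier G" for g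
  proof -
    have g': "inv\<^bsub>G\<^esub> g \<in> carrier G" using g by simp
    have "bij_betw (samuel_action g) points points"
    proof (rule bij_betw_byWitness[where f' = "samuel_action (inv\<^bsub>G\<^esub> g)"])
      show "\<forall>\<xi>\<in>points. samuel_action (inv\<^bsub>G\<^esub> g) (samuel_action g \<xi>) = \<xi>"
        using translation_mult[OF g' g] translation_one translation_point[OF g] g
        by (simp add: samuel_action_def)
      show "\<forall>\<xi>\<in>points. samuel_action g (samuel_action (inv\<^bsub>G\<^esub> g) \<xi>) = \<xi>"
        using translation_mult[OF g g'] translation_one translation_point[OF g'] g
        by (simp add: samuel_action_def)
      show "samuel_action g ` points \<subseteq> points" "samuel_action (inv\<^bsub>G\<^esub> g) ` points \<subseteq> points"
        using translation_point[OF g] translation_point[OF g'] by (auto simp: samuel_action_def)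
    qed
    then show ?thesis by (simp add: Bij_def samuel_action_def)
  qed
  have "samuel_action (g \<otimes>\<^bsub>G\<^esub> h) = compose points (samuel_action g) (samuel_action h)"
    if "g \<in> carrier G" "h \<in> carrier G" for g h
    using translation_mult[OF that] translation_point[OF that(2)]
    by (auto simp: samuel_action_def compose_def fun_eq_iff)
  then have "samuel_action \<in> hom G (BijGroup points)"
    using bij by (auto simp: hom_def BijGroup_def)
  then show ?thesis
    by (intro group_action.intro group_hom.intro group_hom_axioms.intro group_BijGroup)
      (rule group_axioms)
qed

section \<open>The Samuel compactification as a G-compactification\<close>

abbreviation "samuel_space \<equiv> samuel_compactification (topspace X) \<U>"

lemma topspace_samuel: "topspace samuel_space = points"
  unfolding samuel_compactification_def by (rule tb.topspace_completion)

text \<open>Near \<open>g\<close> write k x = (k g^-1)(g x). For the filters in the chosen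
  neighbourhood of \<xi>, eventually \<open>g x\<close> lies in \<open>E\<close>; then k g^-1, taken
  from \<open>N\<close>, moves it only within an element of \<beta> meeting \<open>E\<close>, so the
  result is in \<open>A\<close>. One \<open>N\<close> serves all these filters at once because it
  comes from a uniform cover.\<close>

lemma continuous_samuel_action:
  "continuous_map (prod_topology T samuel_space) samuel_space (\<lambda>(g, \<xi>). samuel_action g \<xi>)"
  unfolding continuous_map_def
proof (intro conjI allI impI)
  show "(\<lambda>(g, \<xi>). samuel_action g \<xi>) \<in>
      topspace (prod_topology T samuel_space) \<rightarrow> topspace samuel_space"
    using translation_point by (auto simp: topspace_samuel topspace_group samuel_action_def)
  fix V assume V: "openin samuel_space V"
  let ?Q = "{p \<in> topspace (prod_topology T samuel_space). (\<lambda>(g, \<xi>). samuel_action g \<xi>) p \<in> V}"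
  show "openin (prod_topology T samuel_space) ?Q"
    unfolding openin_prod_topology_alt
  proof (intro allI impI)
    fix g \<xi> assume "(g, \<xi>) \<in> ?Q"
    then have g: "g \<in> carrier G" and \<xi>: "\<xi> \<in> points" and mem: "filtermap (\<phi> g) \<xi> \<in> V"
      by (auto simp: topspace_samuel topspace_group samuel_action_def)
    obtain A where A: "filtermap (\<phi> g) \<xi> \<in> completion_lift (topspace X) \<P> A"
      "completion_lift (topspace X) \<P> A \<subseteq> V"
      using tb.openin_completionD[OF V[unfolded samuel_compactification_def] mem] .
    have "eventually (\<lambda>x. x \<in> A) (filtermap (\<phi> g) \<xi>)"
      using A(1) by (simp add: completion_lift_def)
    then obtain \<beta> E where b: "\<beta> \<in> \<P>" "E \<in> \<beta>" "eventually (\<lambda>x. x \<in> E) (filtermap (\<phi> g) \<xi>)"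
      "\<forall>C\<in>\<beta>. C \<inter> E \<noteq> {} \<longrightarrow> C \<subseteq> A"
      by (rule tb.point_star_round[OF translation_point[OF g \<xi>]])
    have "\<beta> \<in> \<U>" using b(1) totally_bounded_part_subset by blast
    then obtain N where N: "openin T N" "\<one>\<^bsub>G\<^esub> \<in> N"
      "\<And>x. x \<in> topspace X \<Longrightarrow> \<exists>C\<in>\<beta>. X closure_of ((\<lambda>g. \<phi> g x) ` N) \<subseteq> C"
      using orbit_closure_uniformityE by blast
    have E: "E \<subseteq> topspace X" using tb.Union_member[OF b(1)] b(2) by blast
    have move: "\<phi> h x \<in> A" if x: "x \<in> E" and h: "h \<in> N" for h x
    proof -
      have xX: "x \<in> topspace X" using x E by blast
      obtain C where C: "C \<in> \<beta>" "X closure_of ((\<lambda>g. \<phi> g x) ` N) \<subseteq> C" using N(3)[OF xX] by blast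
      have sub: "(\<lambda>g. \<phi> g x) ` N \<subseteq> C"
        using closure_of_subset[OF orbit_subset[OF N(1) xX]] C(2) by blast
      have "\<phi> \<one>\<^bsub>G\<^esub> x = x" using id_eq_one xX by (metis restrict_apply')
      \<comment> \<open>The identity lies in \<open>N\<close>, so the orbit piece contains
        \<open>x\<close> itself and \<open>C\<close> meets \<open>E\<close>; the margin around
        \<open>E\<close> then gives \<open>C \<subseteq> A\<close>.\<close>
      then have "x \<in> C" using sub N(2) by force
      then have "C \<subseteq> A" using b(4) C(1) x by blast
      then show ?thesis using sub h by blast
    qed
    let ?M = "{k \<in> topspace T. k \<otimes>\<^bsub>G\<^esub> inv\<^bsub>G\<^esub> g \<in> N}"
    let ?L = "completion_lift (topspace X) \<P> {x \<in> topspace X. \<phi> g x \<in> E}"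
    have "openin T ?M"
      by (rule openin_continuous_map_preimage[OF
            topological_group_right_translation_continuous[OF top_group] N(1)]) (simp add: g)
    moreover have "openin samuel_space ?L"
      unfolding samuel_compactification_def by (rule tb.openin_completion_lift)
    moreover have "g \<in> ?M" using g N(2) by (simp add: topspace_group)
    moreover have "\<xi> \<in> ?L"
    proof -
      have "eventually (\<lambda>x. \<phi> g x \<in> E) \<xi>" using b(3) by (simp add: eventually_filtermap)
      then have "eventually (\<lambda>x. x \<in> {x \<in> topspace X. \<phi> g x \<in> E}) \<xi>"
        using tb.pointD(4)[OF \<xi>] by eventually_elim simp
      then show ?thesis using \<xi> by (simp add: completion_lift_def)
    qed
    moreover have "?M \<times> ?L \<subseteq> ?Q"
    proof
      fix p assume "p \<in> ?M \<times> ?L"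
      then obtain k \<zeta> where p: "p = (k, \<zeta>)" and L: "\<zeta> \<in> ?L"
        and k: "k \<in> topspace T" "k \<otimes>\<^bsub>G\<^esub> inv\<^bsub>G\<^esub> g \<in> N" by blast
      have \<zeta>: "\<zeta> \<in> points" "eventually (\<lambda>x. x \<in> {x \<in> topspace X. \<phi> g x \<in> E}) \<zeta>"
        using L by (simp_all add: completion_lift_def)
      have kG: "k \<in> carrier G" using k(1) by (simp add: topspace_group)
      have "eventually (\<lambda>x. \<phi> k x \<in> A) \<zeta>"
        using \<zeta>(2)
      proof (rule eventually_mono)
        fix x assume "x \<in> {x \<in> topspace X. \<phi> g x \<in> E}"
        then have x: "x \<in> topspace X" "\<phi> g x \<in> E" by simp_all
        have "k = k \<otimes>\<^bsub>G\<^esub> inv\<^bsub>G\<^esub> g \<otimes>\<^bsub>G\<^esub> g" using kG g by (simp add: m_assoc)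
        then have "\<phi> k x = \<phi> (k \<otimes>\<^bsub>G\<^esub> inv\<^bsub>G\<^esub> g) (\<phi> g x)"
          using composition_rule[OF x(1), of "k \<otimes>\<^bsub>G\<^esub> inv\<^bsub>G\<^esub> g" g] kG g by simp
        then show "\<phi> k x \<in> A" using move[OF x(2) k(2)] by simp
      qed
      then have "filtermap (\<phi> k) \<zeta> \<in> completion_lift (topspace X) \<P> A"
        using translation_point[OF kG \<zeta>(1)] by (simp add: completion_lift_def eventually_filtermap)
      then show "p \<in> ?Q"
        using A(2) k(1) \<zeta>(1) p by (auto simp: topspace_samuel samuel_action_def)
    qed
    ultimately show "\<exists>M L. openin T M \<and> openin samuel_space L \<and> g \<in> M \<and> \<xi> \<in> L \<and> M \<times> L \<subseteq> ?Q"
      by blast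
  qed
qed

lemma samuel_map_eq_nhdsin: "samuel_map (topspace X) \<U> x = nhdsin X x"
  by (simp add: samuel_map_def completion_map_def uniform_topology_eq)

text \<open>Continuity of the translation yields only one inequality between the two filters.
  Equality follows because the finer one is itself a point, and a point has no strictly coarser
  Cauchy filter.\<close>

lemma samuel_map_equivariant:
  assumes g: "g \<in> carrier G" and x: "x \<in> topspace X"
  shows "samuel_map (topspace X) \<U> (\<phi> g x) = samuel_action g (samuel_map (topspace X) \<U> x)"
proof -
  let ?e = "samuel_map (topspace X) \<U>"
  have pt: "?e y \<in> points" if "y \<in> topspace X" for y
    unfolding samuel_map_def by (rule tb.completion_map_point[OF that])
  have gx: "\<phi> g x \<in> topspace X" using element_image g x by blast
  have "filtermap (\<phi> g) (?e x) \<le> ?e (\<phi> g x)"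
  proof (rule filter_leI)
    fix P assume "eventually P (?e (\<phi> g x))"
    then obtain W where W: "openin X W" "\<phi> g x \<in> W" "\<forall>y\<in>W. P y"
      using gx unfolding samuel_map_eq_nhdsin eventually_nhdsin by blast
    have "openin X {y \<in> topspace X. \<phi> g y \<in> W}"
      by (rule openin_continuous_map_preimage[OF
            G_space_translation_continuous[OF top_group G_space g] W(1)])
    then show "eventually P (filtermap (\<phi> g) (?e x))"
      unfolding eventually_filtermap samuel_map_eq_nhdsin eventually_nhdsin using x W(2,3) by blast
  qed
  then have "?e (\<phi> g x) = filtermap (\<phi> g) (?e x)"
    using translation_point[OF g pt[OF x]] tb.pointD(1)[OF pt[OF gx]]
    unfolding completion_points_def by blast
  then show ?thesis using pt[OF x] by (simp add: samuel_action_def)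
qed

lemma samuel_G_compactification:
  "G_compactification G T X \<phi> samuel_space samuel_action (samuel_map (topspace X) \<U>)"
proof -
  have haus: "Hausdorff_space samuel_space"
    unfolding samuel_compactification_def by (rule tb.Hausdorff_completion)
  have "completely_regular_space samuel_space"
    using compact_samuel_compactification haus compact_Hausdorff_or_regular_imp_normal_space
      normal_imp_completely_regular_space by blast
  then have "G_space G T samuel_space samuel_action"
    using haus samuel_group_action continuous_samuel_action
    by (simp add: G_space_def Tychonoff_space_def topspace_samuel)
  moreover have "embedding_map X samuel_space (samuel_map (topspace X) \<U>)"
    using tb.embedding_completion_map unfolding uniform_topology_eq
    by (simp add: samuel_map_def samuel_compactification_def)
  moreover have "samuel_space closure_of (samuel_map (topspace X) \<U> ` topspace X) =
      topspace samuel_space"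
    unfolding samuel_map_def samuel_compactification_def by (rule tb.dense_completion_map)
  ultimately show ?thesis
    using compact_samuel_compactification samuel_map_equivariant
    by (simp add: G_compactification_def)
qed

section \<open>Maximality among G-compactifications\<close>

lemma equivariant_map_uniform:
  assumes B: "compact_space B" "G_space G T B \<psi>"
    and e: "continuous_map X B e"
    and eq: "\<And>g x. g \<in> carrier G \<Longrightarrow> x \<in> topspace X \<Longrightarrow> e (\<phi> g x) = \<psi> g (e x)"
    and W: "\<forall>W\<in>\<W>. openin B W" "topspace B \<subseteq> \<Union>\<W>"
  shows "(\<lambda>W. {x \<in> topspace X. e x \<in> W}) ` \<W> \<in> \<U>"
proof -
  interpret B: group_action G "topspace B" \<psi> using B(2) by (simp add: G_space_def)
  have "Hausdorff_space B" using B(2) by (simp add: G_space_def Tychonoff_space_def)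
  then have reg: "regular_space B" using B(1) compact_Hausdorff_imp_regular_space by blast
  \<comment> \<open>\<open>N\<close> moves all of \<open>Q\<close> into one element of the cover,
    uniformly in \<open>Q\<close>. Landing in a closed \<open>C\<close> lets the inclusion survive
    passage to the closure of an orbit piece. Continuity of the action at the identity and
    \<open>b\<close> provides such a pair around every \<open>b\<close>.\<close>
  define good where "good Q N \<longleftrightarrow> openin T N \<and> \<one>\<^bsub>G\<^esub> \<in> N \<and>
    (\<exists>W\<in>\<W>. \<exists>C. closedin B C \<and> C \<subseteq> W \<and> (\<forall>h\<in>N. \<forall>q\<in>Q. \<psi> h q \<in> C))" for Q N
  define \<O> where "\<O> = {Q. openin B Q \<and> (\<exists>N. good Q N)}"
  have "\<exists>Q\<in>\<O>. b \<in> Q" if b: "b \<in> topspace B" for b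
  proof -
    obtain W where "W \<in> \<W>" "b \<in> W" using assms(6) b by blast
    moreover obtain V C where V: "openin B V" "closedin B C" "b \<in> V" "V \<subseteq> C" "C \<subseteq> W"
      using regular_space_closed_neighbourhood[OF reg, of W b] assms(5) calculation by blast
    let ?R = "{p \<in> topspace (prod_topology T B). (\<lambda>(g, x). \<psi> g x) p \<in> V}"
    have op: "openin (prod_topology T B) ?R"
      by (rule openin_continuous_map_preimage[OF _ V(1)]) (use B(2) in \<open>simp add: G_space_def\<close>)
    have "\<psi> \<one>\<^bsub>G\<^esub> b = b" using B.id_eq_one b by (metis restrict_apply')
    then have mem: "(\<one>\<^bsub>G\<^esub>, b) \<in> ?R" using b V(3) by (simp add: topspace_group)
    obtain N Q where N: "openin T N" "openin B Q" "\<one>\<^bsub>G\<^esub> \<in> N" "b \<in> Q" "N \<times> Q \<subseteq> ?R"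
      using op[unfolded openin_prod_topology_alt, rule_format, OF mem] by (elim exE conjE)
    have "\<forall>h\<in>N. \<forall>q\<in>Q. \<psi> h q \<in> C" using N(5) V(4) by auto
    then have "good Q N" unfolding good_def using N(1,3) V(2,5) \<open>W \<in> \<W>\<close> by blast
    then show ?thesis using N(2,4) unfolding \<O>_def by blast
  qed
  then have "topspace B \<subseteq> \<Union>\<O>" by blast
  moreover have "\<forall>Q\<in>\<O>. openin B Q" by (simp add: \<O>_def)
  ultimately obtain \<F> where F: "finite \<F>" "\<F> \<subseteq> \<O>" "topspace B \<subseteq> \<Union>\<F>"
    using B(1)[unfolded compact_space_alt, rule_format, of \<O>] by blast
  have "\<forall>Q\<in>\<F>. \<exists>N. good Q N" using F(2) unfolding \<O>_def by blast
  then obtain n where n: "\<And>Q. Q \<in> \<F> \<Longrightarrow> good Q (n Q)" by metis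
  \<comment> \<open>The factor \<open>topspace T\<close> keeps the intersection open when
    \<open>\<F>\<close> is empty and guarantees that \<open>N\<close> consists of group
    elements.\<close>
  define N where "N = (\<Inter>Q\<in>\<F>. n Q) \<inter> topspace T"
  have eX: "e x \<in> topspace B" if "x \<in> topspace X" for x
    using e that unfolding continuous_map_def by blast
  show ?thesis
  proof (rule orbit_closure_uniformityI)
    show "covering_of (topspace X) ((\<lambda>W. {x \<in> topspace X. e x \<in> W}) ` \<W>)"
      using eX W(2) unfolding covering_of_def by blast
    show opN: "openin T N"
      unfolding N_def using n F(1) by (intro openin_INT) (auto simp: good_def)
    show "\<one>\<^bsub>G\<^esub> \<in> N" using n by (auto simp: N_def good_def topspace_group)
    fix x assume x: "x \<in> topspace X"
    then obtain Q where Q: "Q \<in> \<F>" "e x \<in> Q" using F(3) eX by blast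
    obtain W C where C: "W \<in> \<W>" "closedin B C" "C \<subseteq> W" "\<forall>h\<in>n Q. \<forall>q\<in>Q. \<psi> h q \<in> C"
      using n[OF Q(1)] unfolding good_def by (elim conjE bexE exE)
    have "e (\<phi> h x) \<in> C" if "h \<in> N" for h
      using that C(4) Q eq[of h x] x by (simp add: N_def topspace_group)
    then have "(\<lambda>h. \<phi> h x) ` N \<subseteq> {y \<in> topspace X. e y \<in> C}"
      using orbit_subset[OF opN x] by blast
    then have "X closure_of ((\<lambda>h. \<phi> h x) ` N) \<subseteq> {y \<in> topspace X. e y \<in> C}"
      by (rule closure_of_minimal) (rule closedin_continuous_map_preimage[OF e C(2)])
    then have "X closure_of ((\<lambda>h. \<phi> h x) ` N) \<subseteq> {x \<in> topspace X. e x \<in> W}"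
      using C(3) by blast
    then show "\<exists>A\<in>(\<lambda>W. {x \<in> topspace X. e x \<in> W}) ` \<W>. X closure_of ((\<lambda>h. \<phi> h x) ` N) \<subseteq> A"
      using C(1) by blast
  qed
qed

lemma samuel_dominates:
  assumes "G_compactification G T X \<phi> B \<psi> e"
  shows "G_compactification_ge G X samuel_space samuel_action (samuel_map (topspace X) \<U>) B \<psi> e"
proof -
  have B: "compact_space B" "G_space G T B \<psi>" "Hausdorff_space B" and emb: "embedding_map X B e"
    and eq: "\<And>g x. g \<in> carrier G \<Longrightarrow> x \<in> topspace X \<Longrightarrow> e (\<phi> g x) = \<psi> g (e x)"
    using assms by (simp_all add: G_compactification_def G_space_def Tychonoff_space_def)
  have e: "continuous_map X B e"
    using emb continuous_map_in_subtopology homeomorphic_imp_continuous_map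
    unfolding embedding_map_def by blast
  have e_range: "e \<in> topspace X \<rightarrow> topspace B" using e unfolding continuous_map_def by blast
  have unif: "\<forall>\<W>. finite \<W> \<and> (\<forall>W\<in>\<W>. openin B W) \<and> topspace B \<subseteq> \<Union>\<W> \<longrightarrow>
      (\<lambda>W. {x \<in> topspace X. e x \<in> W}) ` \<W> \<in> \<P>"
    using equivariant_map_uniform[OF B(1,2) e eq] by (simp add: finite_in_totally_bounded_part)
  obtain f where f: "continuous_map samuel_space B f"
    and lim: "\<forall>\<xi>\<in>points. limitin B e (f \<xi>) \<xi>"
    using tb.extension_to_compact[OF B(1,3) e_range unif, folded samuel_compactification_def] .
  have "f (samuel_action g \<xi>) = \<psi> g (f \<xi>)" if g: "g \<in> carrier G" and \<xi>: "\<xi> \<in> points" for g \<xi>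
  proof -
    \<comment> \<open>The maps \<open>\<psi> g \<circ> e\<close> and
      \<open>e \<circ> \<phi> g\<close> agree on \<open>topspace X\<close>. Along \<xi> the first
      tends to \<open>\<psi> g (f \<xi>)\<close>, and the second to the value of \<open>f\<close> at
      the translated point.\<close>
    have lim': "limitin B (\<psi> g \<circ> e) (\<psi> g (f \<xi>)) \<xi>"
      by (rule continuous_map_limit[OF G_space_translation_continuous[OF top_group B(2) g]
            bspec[OF lim \<xi>]])
    have cong: "filtermap (\<psi> g \<circ> e) \<xi> = filtermap (e \<circ> \<phi> g) \<xi>"
      by (rule filtermap_cong_on[OF tb.pointD(4)[OF \<xi>]]) (simp add: eq[OF g])
    have "eventually (\<lambda>x. \<psi> g (e x) \<in> W) \<xi> = eventually (\<lambda>x. e (\<phi> g x) \<in> W) \<xi>" for W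
      using arg_cong[OF cong, of "eventually (\<lambda>y. y \<in> W)"] by (simp add: eventually_filtermap)
    then have "limitin B e (\<psi> g (f \<xi>)) (filtermap (\<phi> g) \<xi>)"
      using lim' by (simp add: limitin_def eventually_filtermap)
    then show ?thesis
      using limitin_Hausdorff_unique[OF bspec[OF lim translation_point[OF g \<xi>]] _
          tb.pointD(2)[OF translation_point[OF g \<xi>]] B(3)] \<xi>
      by (simp add: samuel_action_def)
  qed
  moreover have "f (samuel_map (topspace X) \<U> x) = e x" if x: "x \<in> topspace X" for x
  proof -
    \<comment> \<open>The image of \<open>x\<close> is its neighbourhood filter, along which
      continuity makes \<open>e\<close> tend to \<open>e x\<close>; so the chosen limit must be this
      value.\<close>
    have pt: "nhdsin X x \<in> points"
      using tb.completion_map_point[OF x] by (simp add: completion_map_def uniform_topology_eq)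
    show ?thesis
      unfolding samuel_map_eq_nhdsin
      by (rule limitin_Hausdorff_unique[OF bspec[OF lim pt] limitin_nhdsin[OF e x] tb.pointD(2)[OF pt] B(3)])
  qed
  ultimately show ?thesis
    using f unfolding G_compactification_ge_def topspace_samuel by blast
qed

end

theorem theorem2:
  fixes G :: "('g, 'm) monoid_scheme" and T :: "'g topology"
    and X :: "'x topology" and \<phi> :: "'g \<Rightarrow> 'x \<Rightarrow> 'x"
  assumes "topological_group G T"
    and "G_space G T X \<phi>"
    and "covering_uniformity (topspace X) (orbit_closure_uniformity G T X \<phi>)"
    and "compatible_uniformity X (orbit_closure_uniformity G T X \<phi>)"
  shows "\<exists>\<psi>. maximal_G_compactification TYPE('c) G T X \<phi>
           (samuel_compactification (topspace X) (orbit_closure_uniformity G T X \<phi>)) \<psi>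
           (samuel_map (topspace X) (orbit_closure_uniformity G T X \<phi>))"
proof -
  interpret orbit_closure_uniform_space G T X \<phi>
    using assms by (rule orbit_closure_uniform_space.intro)
  show ?thesis
    \<comment> \<open>The witness is \<open>samuel_action\<close>, the same for every type
      \<open>'c\<close> of competing compactifications.\<close>
    unfolding maximal_G_compactification_def
    using samuel_G_compactification samuel_dominates by blast
qed

end
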